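(* Let $W$ be a Weyl group of affine type of rank $n$ and let $c=s_1\cdots s_n=c_{\triangleleft}s_{\mathrm{aff}}c_{\triangleright}$ be a Coxeter element of $W$, acting on the $n$-dimensional complex vector space $V$ spanned by the simple roots (notation as in the context). (1) $c$ has eigenvalue $1$ with algebraic multiplicity $2$ and geometric multiplicity $1$. The imaginary root $\delta$ is a $1$-eigenvector. (2) There exists a unique generalized $1$-eigenvector $\gamma_c$ contained in the subspace $V_{\mathrm{fin}}$ of $V$, meaning that $(c-1)\gamma_c=\delta$. The vector $\gamma_c$ is the unique vector in $V_{\mathrm{fin}}$ that is fixed by $c_{\triangleleft}t_\theta c_{\triangleright}$ and has $K(\theta^\vee,c_{\triangleright}\gamma_c)=1$. (3) There is a linearly independent set of $n-2$ eigenvectors of $c$ whose eigenvalues $\lambda$ are roots of unity with $\lambda\ne1$. (4) The direct sum $U^c$ of all eigenspaces of $c$ is $\{v\in V:K(\gamma_c,v)=0\}$. (5) For $\lambda\ne1$, a vector $v\in V_{\mathrm{fin}}$ is a $\lambda$-eigenvector of $c_{\triangleleft}t_\theta c_{\triangleright}$ if and only if $v+\frac{K(\theta^\vee,\,c_{\triangleright}v)}{\lambda-1}\,\delta$ is a $\lambda$-eigenvector of $c$.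
   Context: Root systems. A symmetrizable (generalized) Cartan matrix is an integer matrix $A=[a_{ij}]_{1\le i,j\le n}$ with diagonal entries $2$, nonpositive off-diagonal entries, and positive reals $d_i$ with $d_ia_{ij}=d_ja_{ji}$ for all $i,j$. Let $V$ be a complex vector space with basis $\alpha_1,\dots,\alpha_n$ (the simple roots), and let $\alpha_i^\vee=d_i^{-1}\alpha_i$ (the simple co-roots). Let $K$ be the symmetric bilinear form on $V$ with $K(\alpha_i^\vee,\alpha_j)=a_{ij}$. The simple reflections are $s_i(v)=v-K(\alpha_i^\vee,v)\alpha_i$; they generate the Weyl group $W\subset GL(V)$, which preserves $K$. The real roots are the vectors $w\alpha_i$ ($w\in W$, $1\le i\le n$). For a real root $\beta$ put $\beta^\vee=\frac{2}{K(\beta,\beta)}\beta$ and $t_\beta x=x-K(\beta^\vee,x)\beta$ (a reflection). For $v\in V$, $[v:\alpha_i]$ denotes the $\alpha_i$-coefficient of $v$ in the basis of simple roots. Affine type. $A$, $W$ are of affine type if $K$ (on the real span of the simple roots) is positive semidefinite, not positive definite, and its restriction to $\mathrm{Span}\{\alpha_i:i\in J\}$ is positive definite for every proper subset $J\subsetneq\{1,\dots,n\}$. Then the kernel of $K$ is one-dimensional and is spanned by a unique vector $\delta=\sum_i[\delta:\alpha_i]\alpha_i$ with coprime positive integer coefficients. The imaginary roots are the vectors $x\delta$ with $x\in\mathbb{Z}\setminus\{0\}$, and the root system $\Phi$ is the union of the sets of real and imaginary roots. Every root is either positive (a nonnegative combination of simple roots) or negative. The affine index. An index $\mathrm{aff}\in\{1,\dots,n\}$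 is fixed (the node $0$ in Kac's labelling; the choice may not be unique) such that, with $V_{\mathrm{fin}}=\mathrm{Span}\{\alpha_i:i\ne\mathrm{aff}\}$, $\Phi_{\mathrm{fin}}=\Phi\cap V_{\mathrm{fin}}$ (an irreducible finite root system) and $W_{\mathrm{fin}}=\langle s_i:i\neq\mathrm{aff}\rangle$, the group $W$ is a semidirect product of $W_{\mathrm{fin}}$ with a lattice of translations and the vector $\theta=\delta-[\delta:\alpha_{\mathrm{aff}}]\alpha_{\mathrm{aff}}$ is a positive root in $\Phi_{\mathrm{fin}}$. (Here $[\delta:\alpha_{\mathrm{aff}}]=1$ except in type $A^{(2)}_{2k}$, where it is $2$.) Coxeter elements. A Coxeter element $c$ is the product of the simple reflections in some order; index so that $c=s_1\cdots s_n$. Put $c_{\triangleleft}=s_1\cdots s_{\mathrm{aff}-1}$ and $c_{\triangleright}=s_{\mathrm{aff}+1}\cdots s_n$, so $c=c_{\triangleleft}s_{\mathrm{aff}}c_{\triangleright}$. *)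

theory Defs
  imports
    "HOL-Analysis.Analysis"
    "HOL-Computational_Algebra.Polynomial"
    "HOL-Algebra.Coset"
    "HOL-Algebra.Generated_Groups"
begin

text \<open>
  The space \<open>V\<close> is \<open>complex ^ 'n\<close> with the standard basis as simple roots, so that \<open>v $ i\<close> is the
  coefficient \<open>[v : \<alpha>\<^sub>i]\<close> and the rank is \<open>CARD('n)\<close>.  The functions \<open>vec.span\<close>, \<open>vec.dim\<close> and
  \<open>vec.dependent\<close> refer to \<open>V\<close> as a complex vector space, whereas plain \<open>span\<close> and \<open>independent\<close>
  refer to \<open>V\<close> as a real one.
\<close>

subsection \<open>Linear algebra\<close>

definition eigenvector ::
    "(complex^'n \<Rightarrow> complex^'n) \<Rightarrow> complex \<Rightarrow> complex^'n \<Rightarrow> bool" where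
  "eigenvector f lam v \<longleftrightarrow> v \<noteq> 0 \<and> f v = lam *s v"

definition eigenspace :: "(complex^'n \<Rightarrow> complex^'n) \<Rightarrow> complex \<Rightarrow> (complex^'n) set" where
  "eigenspace f lam = {v. f v = lam *s v}"

definition geometric_multiplicity :: "(complex^'n \<Rightarrow> complex^'n) \<Rightarrow> complex \<Rightarrow> nat" where
  "geometric_multiplicity f lam = vec.dim (eigenspace f lam)"

definition charpoly :: "(complex^'n \<Rightarrow> complex^'n) \<Rightarrow> complex poly" where
  "charpoly f = det (mat [:0, 1:] - (\<chi> i j. [:matrix f $ i $ j:]))"

definition algebraic_multiplicity :: "(complex^'n \<Rightarrow> complex^'n) \<Rightarrow> complex \<Rightarrow> nat" where
  "algebraic_multiplicity f lam = Polynomial.order lam (charpoly f)"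

text \<open>The sum of all eigenspaces of a linear map (it is always direct).\<close>
definition eigenspace_sum :: "(complex^'n \<Rightarrow> complex^'n) \<Rightarrow> (complex^'n) set" where
  "eigenspace_sum f = vec.span (\<Union>lam. eigenspace f lam)"

definition GL :: "(complex^'n \<Rightarrow> complex^'n) monoid" where
  "GL = \<lparr>carrier = {f. Vector_Spaces.linear (*s) (*s) f \<and> bij f}, monoid.mult = (\<circ>), one = id\<rparr>"

text \<open>A lattice in the real subspace \<open>U\<close>: the integer span of a real basis of \<open>U\<close>.\<close>
definition lattice_in :: "(complex^'n) set \<Rightarrow> (complex^'n) set \<Rightarrow> bool" where
  "lattice_in U L \<longleftrightarrow> (\<exists>B. independent B \<and> span B = U \<and>
     L = {\<Sum>b\<in>B. of_int (m b) *s b | m :: complex^'n \<Rightarrow> int. True})"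

text \<open>\<open>G\<close> is the internal semidirect product of its normal subgroup \<open>N\<close> and its subgroup \<open>H\<close>.\<close>
definition internal_semidirect_product ::
    "('a, 'b) monoid_scheme \<Rightarrow> 'a set \<Rightarrow> 'a set \<Rightarrow> bool" where
  "internal_semidirect_product G N H \<longleftrightarrow>
     N \<lhd> G \<and> subgroup H G \<and> N \<inter> H = {\<one>\<^bsub>G\<^esub>} \<and> N <#>\<^bsub>G\<^esub> H = carrier G"

subsection \<open>Cartan matrices, the form and the Weyl group\<close>

definition symmetrizable_cartan :: "int^'n^'n \<Rightarrow> ('n \<Rightarrow> real) \<Rightarrow> bool" where
  "symmetrizable_cartan A d \<longleftrightarrow>
     (\<forall>i. A $ i $ i = 2) \<and> (\<forall>i j. i \<noteq> j \<longrightarrow> A $ i $ j \<le> 0) \<and>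
     (\<forall>i. d i > 0) \<and> (\<forall>i j. d i * of_int (A $ i $ j) = d j * of_int (A $ j $ i))"

definition simple_root :: "'n \<Rightarrow> complex^'n" where
  "simple_root i = axis i 1"

definition simple_coroot :: "('n \<Rightarrow> real) \<Rightarrow> 'n \<Rightarrow> complex^'n" where
  "simple_coroot d i = of_real (inverse (d i)) *s simple_root i"

text \<open>
  The complex bilinear form determined by \<open>K(\<alpha>\<^sub>i\<^sup>\<or>, \<alpha>\<^sub>j) = a\<^sub>i\<^sub>j\<close>, that is,
  \<open>K(\<alpha>\<^sub>i, \<alpha>\<^sub>j) = d\<^sub>i a\<^sub>i\<^sub>j\<close>; see \<open>K_coroot_root\<close> and \<open>K_sym\<close> below.
\<close>
definition K :: "int^'n^'n \<Rightarrow> ('n \<Rightarrow> real) \<Rightarrow> complex^'n \<Rightarrow> complex^'n \<Rightarrow> complex" where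
  "K A d u v = (\<Sum>i\<in>UNIV. \<Sum>j\<in>UNIV. of_real (d i * of_int (A $ i $ j)) * u $ i * v $ j)"

lemma K_coroot_root:
  assumes "symmetrizable_cartan A d"
  shows "K A d (simple_coroot d i) (simple_root j) = of_int (A $ i $ j)"
proof -
  have d: "d i \<noteq> 0"
    using assms unfolding symmetrizable_cartan_def by (metis less_irrefl)
  have "K A d (simple_coroot d i) (simple_root j) =
      (\<Sum>k\<in>UNIV. \<Sum>l\<in>UNIV. if k = i \<and> l = j
         then of_real (d i * of_int (A $ i $ j)) * of_real (inverse (d i)) else 0)"
    unfolding K_def simple_coroot_def simple_root_def
    by (intro sum.cong refl) (auto simp: axis_def)
  also have "\<dots> = (\<Sum>k\<in>UNIV. if k = i
         then of_real (d i * of_int (A $ i $ j)) * of_real (inverse (d i)) else 0)"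
    by (intro sum.cong refl) simp
  also have "\<dots> = of_int (A $ i $ j)"
    using d by (simp add: field_simps)
  finally show ?thesis .
qed

lemma K_sym:
  assumes "symmetrizable_cartan A d"
  shows "K A d u v = K A d v u"
proof -
  have "d i * of_int (A $ i $ j) = d j * of_int (A $ j $ i)" for i j
    using assms unfolding symmetrizable_cartan_def by blast
  then show ?thesis
    unfolding K_def by (subst sum.swap) (simp add: mult_ac)
qed

definition simple_reflection ::
    "int^'n^'n \<Rightarrow> ('n \<Rightarrow> real) \<Rightarrow> 'n \<Rightarrow> complex^'n \<Rightarrow> complex^'n" where
  "simple_reflection A d i v = v - K A d (simple_coroot d i) v *s simple_root i"

text \<open>The group generated by the \<open>s\<^sub>i\<close> with \<open>i \<in> J\<close>.\<close>
definition parabolic ::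
    "int^'n^'n \<Rightarrow> ('n \<Rightarrow> real) \<Rightarrow> 'n set \<Rightarrow> (complex^'n \<Rightarrow> complex^'n) set" where
  "parabolic A d J = generate GL (simple_reflection A d ` J)"

definition weyl_group ::
    "int^'n^'n \<Rightarrow> ('n \<Rightarrow> real) \<Rightarrow> (complex^'n \<Rightarrow> complex^'n) set" where
  "weyl_group A d = parabolic A d UNIV"

definition coroot :: "int^'n^'n \<Rightarrow> ('n \<Rightarrow> real) \<Rightarrow> complex^'n \<Rightarrow> complex^'n" where
  "coroot A d \<beta> = (2 / K A d \<beta> \<beta>) *s \<beta>"

definition reflection ::
    "int^'n^'n \<Rightarrow> ('n \<Rightarrow> real) \<Rightarrow> complex^'n \<Rightarrow> complex^'n \<Rightarrow> complex^'n" where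
  "reflection A d \<beta> x = x - K A d (coroot A d \<beta>) x *s \<beta>"

text \<open>The product \<open>s\<^bsub>i1\<^esub> \<cdots> s\<^bsub>ik\<^esub>\<close>; its rightmost factor is applied first.\<close>
definition refl_product ::
    "int^'n^'n \<Rightarrow> ('n \<Rightarrow> real) \<Rightarrow> 'n list \<Rightarrow> complex^'n \<Rightarrow> complex^'n" where
  "refl_product A d is = foldr (\<lambda>i f. simple_reflection A d i \<circ> f) is id"

subsection \<open>Affine type\<close>

text \<open>\<open>K\<close> takes real values on the real span of the simple roots.\<close>

definition pos_semidef_on :: "int^'n^'n \<Rightarrow> ('n \<Rightarrow> real) \<Rightarrow> 'n set \<Rightarrow> bool" where
  "pos_semidef_on A d J \<longleftrightarrow> (\<forall>v \<in> span (simple_root ` J). Re (K A d v v) \<ge> 0)"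

definition pos_def_on :: "int^'n^'n \<Rightarrow> ('n \<Rightarrow> real) \<Rightarrow> 'n set \<Rightarrow> bool" where
  "pos_def_on A d J \<longleftrightarrow> (\<forall>v \<in> span (simple_root ` J). v \<noteq> 0 \<longrightarrow> Re (K A d v v) > 0)"

definition affine_type :: "int^'n^'n \<Rightarrow> ('n \<Rightarrow> real) \<Rightarrow> bool" where
  "affine_type A d \<longleftrightarrow> pos_semidef_on A d UNIV \<and> \<not> pos_def_on A d UNIV \<and>
     (\<forall>J. J \<subset> UNIV \<longrightarrow> pos_def_on A d J)"

definition form_kernel :: "int^'n^'n \<Rightarrow> ('n \<Rightarrow> real) \<Rightarrow> (complex^'n) set" where
  "form_kernel A d = {u. \<forall>v. K A d u v = 0}"

definition delta :: "int^'n^'n \<Rightarrow> ('n \<Rightarrow> real) \<Rightarrow> complex^'n" where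
  "delta A d = (THE v. form_kernel A d = vec.span {v} \<and>
     (\<exists>m :: 'n \<Rightarrow> int. (\<forall>i. m i > 0) \<and> Gcd (range m) = 1 \<and>
        v = (\<Sum>i\<in>UNIV. of_int (m i) *s simple_root i)))"

definition real_roots :: "int^'n^'n \<Rightarrow> ('n \<Rightarrow> real) \<Rightarrow> (complex^'n) set" where
  "real_roots A d = {w (simple_root i) | w i. w \<in> weyl_group A d}"

definition imaginary_roots :: "int^'n^'n \<Rightarrow> ('n \<Rightarrow> real) \<Rightarrow> (complex^'n) set" where
  "imaginary_roots A d = {of_int x *s delta A d | x :: int. x \<noteq> 0}"

definition roots :: "int^'n^'n \<Rightarrow> ('n \<Rightarrow> real) \<Rightarrow> (complex^'n) set" where
  "roots A d = real_roots A d \<union> imaginary_roots A d"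

definition positive_root :: "int^'n^'n \<Rightarrow> ('n \<Rightarrow> real) \<Rightarrow> complex^'n \<Rightarrow> bool" where
  "positive_root A d \<beta> \<longleftrightarrow> \<beta> \<in> roots A d \<and>
     (\<exists>m :: 'n \<Rightarrow> real. (\<forall>i. m i \<ge> 0) \<and> \<beta> = (\<Sum>i\<in>UNIV. of_real (m i) *s simple_root i))"

subsection \<open>The affine index\<close>

definition V_fin :: "'n \<Rightarrow> (complex^'n) set" where
  "V_fin aff = vec.span (simple_root ` (- {aff}))"

definition roots_fin :: "int^'n^'n \<Rightarrow> ('n \<Rightarrow> real) \<Rightarrow> 'n \<Rightarrow> (complex^'n) set" where
  "roots_fin A d aff = roots A d \<inter> V_fin aff"

definition theta :: "int^'n^'n \<Rightarrow> ('n \<Rightarrow> real) \<Rightarrow> 'n \<Rightarrow> complex^'n" where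
  "theta A d aff = delta A d - (delta A d $ aff) *s simple_root aff"

text \<open>
  The translations of an affine Weyl group act on the affine hyperplanes \<open>{\<phi>. \<phi>(\<delta>) = const}\<close> of
  the dual space of \<open>V\<close>.  On \<open>V\<close> itself, translation by \<open>\<mu> \<in> V\<^sub>f\<^sub>i\<^sub>n\<close> is the following transvection.
\<close>
definition translation ::
    "int^'n^'n \<Rightarrow> ('n \<Rightarrow> real) \<Rightarrow> complex^'n \<Rightarrow> complex^'n \<Rightarrow> complex^'n" where
  "translation A d \<mu> v = v + K A d \<mu> v *s delta A d"

definition affine_index :: "int^'n^'n \<Rightarrow> ('n \<Rightarrow> real) \<Rightarrow> 'n \<Rightarrow> bool" where
  "affine_index A d aff \<longleftrightarrow>
     (\<exists>L. lattice_in (span (simple_root ` (- {aff}))) L \<and>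
        internal_semidirect_product (GL\<lparr>carrier := weyl_group A d\<rparr>)
          (translation A d ` L) (parabolic A d (- {aff}))) \<and>
     theta A d aff \<in> roots_fin A d aff \<and> positive_root A d (theta A d aff)"

definition gen_eigenvector_fin ::
    "int^'n^'n \<Rightarrow> ('n \<Rightarrow> real) \<Rightarrow> 'n \<Rightarrow> (complex^'n \<Rightarrow> complex^'n) \<Rightarrow> complex^'n \<Rightarrow> bool" where
  "gen_eigenvector_fin A d aff c \<gamma> \<longleftrightarrow> \<gamma> \<in> V_fin aff \<and> c \<gamma> - \<gamma> = delta A d"

definition gamma ::
    "int^'n^'n \<Rightarrow> ('n \<Rightarrow> real) \<Rightarrow> 'n \<Rightarrow> (complex^'n \<Rightarrow> complex^'n) \<Rightarrow> complex^'n" where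
  "gamma A d aff c = (THE \<gamma>. gen_eigenvector_fin A d aff c \<gamma>)"

end

theory Submission
  imports Defs
begin

text \<open>
  The argument avoids the classification of affine types.  The vectors fixed by \<open>c\<close> form the kernel
  of \<open>K\<close>, which is spanned by \<open>\<delta>\<close> (Perron--Frobenius, together with \<open>det A = 0\<close> for integrality).
  Since \<open>c\<close> is a product of reflections over a basis, \<open>(c - 1) y = v\<close> amounts to prescribing the
  numbers \<open>K(\<alpha>\<^sub>i\<^sup>\<or>, y)\<close> triangularly in terms of \<open>v\<close>; by symmetry of \<open>K\<close> this is solvable exactly when
  one linear functional, the Euler form with \<open>\<delta>\<close>, vanishes at \<open>v\<close>.  It vanishes at \<open>\<delta>\<close> because
  \<open>K(\<delta>, \<delta>) = 0\<close>, which gives \<open>\<gamma>\<close>, and it is proportional to \<open>K(\<gamma>, \<cdot>)\<close>.  The action of \<open>c\<close> on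
  \<open>V / \<delta>\<close> preserves a lattice and a definite form, so \<open>(c\<^sup>N - 1) V \<subseteq> \<complex> \<delta>\<close> for some \<open>N > 0\<close>; hence
  \<open>c\<^sup>N = 1\<close> on the image of \<open>c - 1\<close>, which is \<open>{v. K(\<gamma>, v) = 0}\<close>, and \<open>c\<close> is diagonalizable there.
  The statements about \<open>t\<^sub>\<theta>\<close> follow from \<open>s\<^sub>a\<^sub>f\<^sub>f = t\<^sub>\<theta> + K(\<theta>\<^sup>\<or>, \<cdot>) \<delta>\<close>.
\<close>

subsection \<open>Linear algebra\<close>

text \<open>Carries the vanishing of a determinant from the reals to the integers and on to the
  rationals.\<close>

lemma det_of_int:
  fixes M :: "int^'n^'n"
  shows "det ((\<chi> i j. of_int (M $ i $ j)) :: 'a::comm_ring_1^'n^'n) = of_int (det M)"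
  by (simp add: det_def)

lemma det_eq_0_iff_kernel:
  fixes M :: "'a::field^'n^'n"
  shows "det M = 0 \<longleftrightarrow> (\<exists>x. x \<noteq> 0 \<and> M *v x = 0)"
  using invertible_det_nz[of M] matrix_left_invertible_ker[of M] invertible_left_inverse[of M]
  by blast

lemma rat_common_denominator:
  fixes q :: "'n::finite \<Rightarrow> rat"
  obtains D :: int and z :: "'n \<Rightarrow> int" where "D > 0" "\<And>i. of_int D * q i = of_int (z i)"
proof -
  define D where "D = (\<Prod>i\<in>UNIV. snd (quotient_of (q i)))"
  have "\<exists>z. of_int D * q i = of_int z" for i
  proof -
    obtain a b where ab: "quotient_of (q i) = (a, b)"
      by (cases "quotient_of (q i)")
    have "b > 0"
      using quotient_of_denom_pos[OF ab] .
    moreover have "q i = of_int a / of_int b"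
      using quotient_of_div[OF ab] .
    moreover have "D = b * (\<Prod>j\<in>UNIV - {i}. snd (quotient_of (q j)))"
      using ab by (simp add: D_def prod.remove[of UNIV i])
    ultimately have "of_int D * q i = of_int (a * (\<Prod>j\<in>UNIV - {i}. snd (quotient_of (q j))))"
      by simp
    then show ?thesis
      by blast
  qed
  then obtain z where "\<And>i. of_int D * q i = of_int (z i)"
    by metis
  moreover have "D > 0"
    unfolding D_def using quotient_of_denom_pos by (intro prod_pos) (metis prod.collapse)
  ultimately show thesis
    using that by blast
qed

text \<open>Discrete Fourier transform: \<open>w j\<close> is the component of \<open>v\<close> for
  the character \<open>\<omega> ^ j\<close> of the cyclic group of order \<open>N\<close>. Only the
  orbit of \<open>v\<close> has to close up; \<open>f\<close> may have infinite order.\<close>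

lemma root_of_unity_decomposition:
  fixes f :: "complex^'n \<Rightarrow> complex^'n"
  assumes f: "Vector_Spaces.linear (*s) (*s) f" and N: "N > 0" and v: "(f ^^ N) v = v"
  obtains w \<zeta> where "v = (\<Sum>j<N. w j)" "\<And>j. f (w j) = \<zeta> j *s w j" "\<And>j. \<zeta> j ^ N = 1"
proof -
  define \<omega> where "\<omega> = exp (2 * of_real pi * \<i> / of_nat N)"
  have \<omega>_pow: "\<omega> ^ k = exp (2 * of_real pi * \<i> * of_nat k / of_nat N)" for k
    unfolding \<omega>_def by (subst exp_of_nat_mult [symmetric]) (simp add: mult_ac)
  have \<omega>_1: "\<omega> ^ k = 1 \<longleftrightarrow> N dvd k" for k
    unfolding \<omega>_pow using N by (intro complex_root_unity_eq_1) auto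
  have [simp]: "\<omega> \<noteq> 0"
    by (simp add: \<omega>_def)
  define w where "w j = (\<Sum>k<N. (inverse (\<omega> ^ j) ^ k / of_nat N) *s (f ^^ k) v)" for j
  have "v = (\<Sum>j<N. w j)"
  proof -
    \<comment> \<open>Orthogonality of characters: for \<open>k \<noteq> 0\<close> this is a full
      geometric sum over a root of unity other than 1.\<close>
    have *: "(\<Sum>j<N. inverse (\<omega> ^ j) ^ k) = (if k = 0 then of_nat N else 0)" if "k < N" for k
    proof (cases "k = 0")
      case False
      let ?x = "inverse (\<omega> ^ k)"
      have "?x \<noteq> 1"
        using False that \<omega>_1[of k] by (auto dest: dvd_imp_le)
      moreover have "?x ^ N = 1"
        using \<omega>_1[of "k * N"] by (simp add: power_inverse flip: power_mult)
      ultimately have "(\<Sum>j<N. ?x ^ j) = 0"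
        by (simp add: geometric_sum)
      with False show ?thesis
        by (simp add: power_inverse mult.commute flip: power_mult)
    qed simp
    have "(\<Sum>j<N. w j) = (\<Sum>k<N. ((\<Sum>j<N. inverse (\<omega> ^ j) ^ k) / of_nat N) *s (f ^^ k) v)"
      unfolding w_def by (subst sum.swap) (simp add: vec.scale_sum_left sum_divide_distrib)
    also have "\<dots> = (\<Sum>k<N. if k = 0 then v else 0)"
      using N by (intro sum.cong refl) (auto simp: *)
    also have "\<dots> = v"
      using N by simp
    finally show ?thesis ..
  qed
  moreover have "f (w j) = \<omega> ^ j *s w j" for j
  proof -
    define g where "g k = (inverse (\<omega> ^ j) ^ k / of_nat N) *s (f ^^ k) v" for k
    have "inverse (\<omega> ^ j) ^ N = 1"
      using \<omega>_1[of "j * N"] by (simp add: power_inverse flip: power_mult)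
    \<comment> \<open>The two end terms agree, so the index shift caused by \<open>f\<close> does
      not change the sum.\<close>
    then have "g N = g 0"
      by (simp add: g_def v)
    have "f (w j) = (\<Sum>k<N. \<omega> ^ j *s g (Suc k))"
      unfolding w_def g_def using f
      by (simp add: vec.linear_sum vec.linear_scale field_simps)
    also have "\<dots> = \<omega> ^ j *s (\<Sum>k<N. g (Suc k))"
      by (simp add: vec.scale_sum_right)
    also have "(\<Sum>k<N. g (Suc k)) = (\<Sum>k<N. g k)"
      using sum.lessThan_Suc[of g N] sum.lessThan_Suc_shift[of g N] \<open>g N = g 0\<close> by (simp add: add.commute)
    finally show ?thesis
      by (simp add: w_def g_def)
  qed
  moreover have "(\<omega> ^ j) ^ N = 1" for j
    using \<omega>_1[of "j * N"] by (simp flip: power_mult)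
  ultimately show thesis
    by (rule that)
qed

section \<open>Determinants and characteristic polynomials\<close>

lemma poly_det: "poly (det M) x = det (\<chi> i j. poly (M $ i $ j) x)"
  for M :: "complex poly^'n^'n"
  by (simp add: det_def poly_sum poly_prod poly_mult)

text \<open>In the expansion of the determinant only the identity contributes: any other permutation
  moves at least two points and hence meets a zero entry.\<close>
lemma det_single_offdiag:
  fixes M :: "'a::comm_ring_1^'n^'n"
  assumes "\<And>i j. i \<noteq> j \<Longrightarrow> j \<noteq> p \<Longrightarrow> M $ i $ j = 0"
  shows "det M = (\<Prod>i\<in>UNIV. M $ i $ i)"
proof -
  have "(\<Prod>i\<in>UNIV. M $ i $ \<pi> i) = 0" if \<pi>: "\<pi> permutes UNIV" "\<pi> \<noteq> id" for \<pi>
  proof -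
    have inj: "inj \<pi>"
      using \<pi>(1) by (rule permutes_inj)
    obtain a where a: "\<pi> a \<noteq> a"
      using \<pi>(2) by (auto simp: fun_eq_iff)
    then have "\<pi> (\<pi> a) \<noteq> \<pi> a"
      using inj by (auto dest: injD)
    with a inj have "\<exists>i. \<pi> i \<noteq> i \<and> \<pi> i \<noteq> p"
      by (metis injD)
    then obtain i where "M $ i $ \<pi> i = 0"
      using assms by metis
    then show ?thesis
      by (meson UNIV_I finite prod_zero)
  qed
  then have "det M = (\<Sum>\<pi>\<in>{id}. of_int (sign \<pi>) * (\<Prod>i\<in>UNIV. M $ i $ \<pi> i))"
    unfolding det_def by (intro sum.mono_neutral_right) (auto simp: permutes_id)
  then show ?thesis
    by (simp add: sign_id)
qed

text \<open>In the basis \<open>e\<close> the map is diagonal apart from one entry 1 in row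
  \<open>q\<close> and column \<open>p\<close>. The identity is checked at each complex
  \<open>x\<close>, so that the change of basis takes place over a field.\<close>

lemma charpoly_almost_diagonal:
  fixes f :: "complex^'n \<Rightarrow> complex^'n" and e :: "'n \<Rightarrow> complex^'n"
  assumes f: "Vector_Spaces.linear (*s) (*s) f"
    and e: "inj e" "\<not> vec.dependent (range e)"
    and diag: "\<And>i. i \<noteq> p \<Longrightarrow> f (e i) = \<mu> i *s e i"
    and offdiag: "f (e p) = \<mu> p *s e p + e q" "q \<noteq> p"
  shows "charpoly f = (\<Prod>i\<in>UNIV. [:- \<mu> i, 1:])"
proof -
  define P :: "complex^'n^'n" where "P = (\<chi> i j. e j $ i)"
  have P: "P *v x = (\<Sum>j\<in>UNIV. x $ j *s e j)" for x
    by (simp add: P_def vec_eq_iff matrix_vector_mult_def mult.commute)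
  have "x = 0" if "P *v x = 0" for x
  proof -
    have "(\<Sum>v\<in>range e. x $ inv_into UNIV e v *s v) = 0"
      using that e(1) by (simp add: P sum.reindex)
    then have "x $ inv_into UNIV e v = 0" if "v \<in> range e" for v
      using vec.independentD[OF e(2), of "range e" "\<lambda>v. x $ inv_into UNIV e v"] that by simp
    then have "x $ i = 0" for i
      using e(1) by (metis inv_f_f rangeI)
    then show ?thesis
      by (simp add: vec_eq_iff)
  qed
  then have "det P \<noteq> 0"
    by (auto simp: det_eq_0_iff_kernel)
  have "poly (charpoly f) x = poly (\<Prod>i\<in>UNIV. [:- \<mu> i, 1:]) x" for x
  proof -
    \<comment> \<open>The matrix of \<open>x - f\<close> in the basis \<open>e\<close>.\<close>
    define T :: "complex^'n^'n" where
      "T = (\<chi> i j. if i = j then x - \<mu> i else if i = q \<and> j = p then - 1 else 0)"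
    have "poly (charpoly f) x = det (mat x - matrix f)"
      unfolding charpoly_def poly_det
      by (intro arg_cong[of _ _ det]) (auto simp: vec_eq_iff mat_def)
    moreover have "(mat x - matrix f) ** P = P ** T"
    proof -
      have fe: "(\<Sum>k\<in>UNIV. matrix f $ i $ k * e j $ k) = f (e j) $ i" for i j
        using matrix_works[OF f, of "e j"] by (simp add: vec_eq_iff matrix_vector_mult_def)
      have "((mat x - matrix f) ** P) $ i $ j = x * e j $ i - f (e j) $ i" for i j
        by (simp add: matrix_matrix_mult_def P_def mat_def left_diff_distrib sum_subtractf fe
            if_distrib[of "\<lambda>y. y * _"] sum.delta' cong: if_cong)
      moreover have "(P ** T) $ i $ j = x * e j $ i - f (e j) $ i" for i j
      proof -
        have "(P ** T) $ i $ j = (\<Sum>k\<in>UNIV. (if k = j then e j $ i * (x - \<mu> j) else 0)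
            - (if k = q then (if j = p then e q $ i else 0) else 0))"
          unfolding matrix_matrix_mult_def P_def T_def using offdiag(2) by (simp only: vec_lambda_beta, intro sum.cong refl) auto
        also have "\<dots> = x * e j $ i - f (e j) $ i"
          using diag[of j] offdiag(1) by (auto simp: sum_subtractf algebra_simps)
        finally show ?thesis .
      qed
      ultimately show ?thesis
        by (simp add: vec_eq_iff)
    qed
    then have "det (mat x - matrix f) = det T"
      using \<open>det P \<noteq> 0\<close> by (metis det_mul mult.commute mult_cancel_left)
    moreover have "det T = (\<Prod>i\<in>UNIV. x - \<mu> i)"
      by (subst det_single_offdiag[of p]) (auto simp: T_def)
    ultimately show ?thesis
      by (simp add: poly_prod)
  qed
  then show ?thesis
    by (simp add: poly_eq_poly_eq_iff[symmetric] fun_eq_iff)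
qed

section \<open>Coordinates with respect to the simple roots\<close>

lemma vec_expansion: "v = (\<Sum>i\<in>UNIV. v $ i *s simple_root i)"
  by (simp add: vec_eq_iff simple_root_def axis_def if_distrib[of "\<lambda>x. _ * x"] sum.delta cong: if_cong)

lemma simple_root_nth [simp]: "simple_root i $ j = (if i = j then 1 else 0)"
  by (simp add: simple_root_def axis_def)

lemma V_fin_iff: "v \<in> V_fin a \<longleftrightarrow> v $ a = 0"
proof
  have "vec.subspace {v. v $ a = 0}"
    by (simp add: vec.subspace_def)
  moreover have "simple_root ` (- {a}) \<subseteq> {v. v $ a = 0}"
    by auto
  ultimately have "V_fin a \<subseteq> {v. v $ a = 0}"
    unfolding V_fin_def by (rule vec.span_minimal[rotated])
  then show "v \<in> V_fin a \<Longrightarrow> v $ a = 0"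
    by blast
next
  assume "v $ a = 0"
  then have "v $ i *s simple_root i \<in> V_fin a" for i
    unfolding V_fin_def
    by (cases "i = a") (auto intro: vec.span_scale vec.span_base simp: vec.span_zero)
  then have "(\<Sum>i\<in>UNIV. v $ i *s simple_root i) \<in> V_fin a"
    unfolding V_fin_def by (intro vec.span_sum) auto
  then show "v \<in> V_fin a"
    by (simp flip: vec_expansion)
qed

subsection \<open>The form and products of simple reflections\<close>

locale cartan =
  fixes A :: "int^'n^'n" and d :: "'n \<Rightarrow> real"
  assumes symmetrizable: "symmetrizable_cartan A d"
begin

abbreviation "B \<equiv> K A d"
abbreviation "s \<equiv> simple_reflection A d"

text \<open>Stands for \<open>B (simple_coroot d i) v\<close>. Written with the entries of
  \<open>A\<close> alone, it is visibly integral on integer vectors.\<close>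

definition pairing :: "'n \<Rightarrow> complex^'n \<Rightarrow> complex" where
  "pairing i v = (\<Sum>j\<in>UNIV. of_int (A $ i $ j) * v $ j)"

lemma diag: "A $ i $ i = 2" and offdiag: "i \<noteq> j \<Longrightarrow> A $ i $ j \<le> 0"
  and d_pos: "d i > 0"
  using symmetrizable by (auto simp: symmetrizable_cartan_def)

lemma pairing_add [simp]: "pairing i (u + v) = pairing i u + pairing i v"
  and pairing_diff [simp]: "pairing i (u - v) = pairing i u - pairing i v"
  and pairing_scale [simp]: "pairing i (a *s v) = a * pairing i v"
  and pairing_zero [simp]: "pairing i 0 = 0"
  by (simp_all add: pairing_def algebra_simps sum.distrib sum_subtractf sum_distrib_left)

lemma pairing_sum [simp]: "pairing i (\<Sum>x\<in>X. f x) = (\<Sum>x\<in>X. pairing i (f x))"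
  by (induction X rule: infinite_finite_induct) auto

lemma pairing_simple_root [simp]: "pairing i (simple_root j) = of_int (A $ i $ j)"
  by (simp add: pairing_def if_distrib[of "\<lambda>x. _ * x"] sum.delta cong: if_cong)

lemma B_eq: "B u v = (\<Sum>i\<in>UNIV. of_real (d i) * u $ i * pairing i v)"
  by (simp add: K_def pairing_def sum_distrib_left mult_ac)

lemma B_add_left [simp]: "B (u + v) w = B u w + B v w"
  and B_add_right [simp]: "B u (v + w) = B u v + B u w"
  and B_diff_left [simp]: "B (u - v) w = B u w - B v w"
  and B_diff_right [simp]: "B u (v - w) = B u v - B u w"
  and B_scale_left [simp]: "B (a *s v) w = a * B v w"
  and B_scale_right [simp]: "B v (a *s w) = a * B v w"
  and B_zero_left [simp]: "B 0 v = 0"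
  and B_zero_right [simp]: "B v 0 = 0"
  by (simp_all add: B_eq algebra_simps sum.distrib sum_subtractf sum_distrib_left)

lemma B_commute: "B u v = B v u"
  using symmetrizable by (rule K_sym)

lemma B_simple_root_left [simp]: "B (simple_root i) v = of_real (d i) * pairing i v"
  by (simp add: B_eq if_distrib[of "\<lambda>x. _ * x"] if_distrib[of "\<lambda>x. x * _"] sum.delta cong: if_cong)

lemma B_simple_coroot_left [simp]: "B (simple_coroot d i) v = pairing i v"
  using d_pos[of i] by (simp add: simple_coroot_def)

lemma form_kernel_iff: "v \<in> form_kernel A d \<longleftrightarrow> (\<forall>i. pairing i v = 0)"
proof
  assume v: "v \<in> form_kernel A d"
  show "\<forall>i. pairing i v = 0"
  proof
    fix i
    have "B (simple_root i) v = 0"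
      using v by (subst B_commute) (auto simp: form_kernel_def)
    then show "pairing i v = 0"
      using d_pos[of i] by simp
  qed
next
  assume "\<forall>i. pairing i v = 0"
  then show "v \<in> form_kernel A d"
    by (subst form_kernel_def, subst B_commute) (simp add: B_eq)
qed

lemma s_eq: "s i v = v - pairing i v *s simple_root i"
  by (simp add: simple_reflection_def)

lemma s_involution [simp]: "s i (s i v) = v"
  by (simp add: s_eq diag)

lemma B_s: "B (s i u) (s i v) = B u v"
proof -
  have "B u (simple_root i) = of_real (d i) * pairing i u" for u
    by (subst B_commute) simp
  then show ?thesis
    by (simp add: s_eq algebra_simps diag)
qed

lemma linear_s: "Vector_Spaces.linear (*s) (*s) (s i)"
  by (intro Vector_Spaces.linear_iff[THEN iffD2])
     (auto simp: vec.vector_space_axioms s_eq algebra_simps)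

lemma refl_product_Nil [simp]: "refl_product A d [] v = v"
  and refl_product_Cons [simp]: "refl_product A d (i # is) v = s i (refl_product A d is v)"
  by (simp_all add: refl_product_def)

lemma refl_product_append:
  "refl_product A d (is @ js) v = refl_product A d is (refl_product A d js v)"
  by (induction "is") auto

lemma linear_refl_product: "Vector_Spaces.linear (*s) (*s) (refl_product A d is)"
proof (induction "is")
  case Nil
  then show ?case
    by (simp add: refl_product_def vec.linear_ident)
next
  case (Cons i "is")
  have "refl_product A d (i # is) = s i \<circ> refl_product A d is"
    by auto
  then show ?case
    using Vector_Spaces.linear_compose[OF Cons linear_s] by (simp only:)
qed

lemma B_refl_product: "B (refl_product A d is u) (refl_product A d is v) = B u v"
  by (induction "is") (auto simp: B_s)

lemma refl_product_rev [simp]: "refl_product A d is (refl_product A d (rev is) v) = v"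
  by (induction "is" arbitrary: v) (auto simp: refl_product_append)

lemma refl_product_form_kernel:
  "v \<in> form_kernel A d \<Longrightarrow> refl_product A d is v = v"
  by (induction "is") (auto simp: s_eq form_kernel_iff)

lemma refl_product_nth: "i \<notin> set is \<Longrightarrow> refl_product A d is v $ i = v $ i"
  by (induction "is") (auto simp: s_eq)

lemma refl_product_Ints:
  "(\<And>i. v $ i \<in> \<int>) \<Longrightarrow> refl_product A d is v $ j \<in> \<int>"
proof (induction "is" arbitrary: j)
  case (Cons i "is")
  then have "pairing i (refl_product A d is v) \<in> \<int>"
    unfolding pairing_def by (intro Ints_sum Ints_mult) auto
  with Cons show ?case
    by (auto simp: s_eq)
qed auto

text \<open>The first letter \<open>j\<close> does not recur, so the remaining product leaves
  coordinate \<open>j\<close> alone. As that product sends \<open>v\<close> to \<open>s j v\<close>,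
  the pairing with \<open>j\<close> vanishes, \<open>s j\<close> fixes \<open>v\<close>, and
  induction applies.\<close>

lemma refl_product_fixed:
  assumes "distinct is" "refl_product A d is v = v" "i \<in> set is"
  shows "pairing i v = 0"
  using assms
proof (induction "is")
  case (Cons j "is")
  have *: "refl_product A d is v = s j v"
    using Cons.prems(2) by (metis refl_product_Cons s_involution)
  then have "s j v $ j = v $ j"
    using refl_product_nth[of j "is" v] Cons.prems(1) by simp
  then have "pairing j v = 0"
    by (simp add: s_eq)
  with * Cons show ?case
    by (auto simp: s_eq)
qed simp

end

text \<open>The real kernel vector gives \<open>det A = 0\<close>, hence a rational kernel vector,
  whose denominators are cleared.\<close>

lemma (in cartan) integer_kernel_vector:
  fixes x :: "real^'n"
  assumes "x \<noteq> 0" "\<And>i. (\<Sum>j\<in>UNIV. of_int (A $ i $ j) * x $ j) = 0"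
  obtains z :: "'n \<Rightarrow> int" where "z \<noteq> (\<lambda>_. 0)" "\<And>i. (\<Sum>j\<in>UNIV. A $ i $ j * z j) = 0"
proof -
  let ?R = "(\<chi> i j. of_int (A $ i $ j)) :: real^'n^'n"
  have "?R *v x = 0"
    using assms(2) by (simp add: vec_eq_iff matrix_vector_mult_def)
  then have "det ?R = 0"
    using assms(1) by (auto simp: det_eq_0_iff_kernel)
  then have "det A = 0"
    unfolding det_of_int by simp
  then have "det ((\<chi> i j. of_int (A $ i $ j)) :: rat^'n^'n) = 0"
    unfolding det_of_int by simp
  then obtain q where q: "q \<noteq> 0" "((\<chi> i j. of_int (A $ i $ j)) :: rat^'n^'n) *v q = 0"
    by (auto simp: det_eq_0_iff_kernel)
  obtain D z where D: "D > 0" and z: "\<And>i. of_int D * q $ i = of_int (z i)"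
    using rat_common_denominator[of "\<lambda>i. q $ i"] by blast
  have "z \<noteq> (\<lambda>_. 0)"
  proof
    assume "z = (\<lambda>_. 0)"
    then have "q $ i = 0" for i
      using z[of i] D by simp
    with q(1) show False
      by (simp add: vec_eq_iff)
  qed
  moreover have "(\<Sum>j\<in>UNIV. A $ i $ j * z j) = 0" for i
  proof -
    have "rat_of_int (\<Sum>j\<in>UNIV. A $ i $ j * z j) = of_int D * (\<Sum>j\<in>UNIV. of_int (A $ i $ j) * q $ j)"
      by (simp add: sum_distrib_left flip: z) (simp add: mult_ac)
    also have "(\<Sum>j\<in>UNIV. rat_of_int (A $ i $ j) * q $ j) = 0"
      using q(2) by (simp add: vec_eq_iff matrix_vector_mult_def)
    finally have "rat_of_int (\<Sum>j\<in>UNIV. A $ i $ j * z j) = of_int 0"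
      by simp
    then show ?thesis
      unfolding of_int_eq_iff .
  qed
  ultimately show thesis
    using that by blast
qed

section \<open>Real vectors inside the complex space\<close>

definition rvec :: "('n \<Rightarrow> real) \<Rightarrow> complex^'n" where
  "rvec x = (\<chi> i. of_real (x i))"

lemma rvec_nth [simp]: "rvec x $ i = of_real (x i)"
  by (simp add: rvec_def)

lemma rvec_in_span:
  assumes "\<And>i. i \<notin> J \<Longrightarrow> x i = 0"
  shows "rvec x \<in> span (simple_root ` J)"
proof -
  have "rvec x = (\<Sum>i\<in>UNIV. x i *\<^sub>R simple_root i)"
    by (simp add: vec_eq_iff if_distrib[of "\<lambda>x. _ * x"] if_distrib[of "\<lambda>y. _ *\<^sub>R y"] sum.delta scaleR_conv_of_real[where 'a = complex] cong: if_cong)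
  also have "\<dots> = (\<Sum>i\<in>J. x i *\<^sub>R simple_root i)"
    using assms by (intro sum.mono_neutral_right) auto
  also have "\<dots> \<in> span (simple_root ` J)"
    by (intro span_sum span_scale span_base) auto
  finally show ?thesis .
qed

lemma span_simple_root_real:
  assumes "v \<in> span (range simple_root)"
  obtains x where "v = rvec x"
proof -
  have "span (range simple_root) \<subseteq> range (rvec :: _ \<Rightarrow> complex^'a)"
  proof (rule span_minimal)
    show "range simple_root \<subseteq> range (rvec :: _ \<Rightarrow> complex^'a)"
    proof safe
      fix i :: 'a
      have "simple_root i = rvec (\<lambda>j. if i = j then 1 else 0)"
        by (simp add: vec_eq_iff)
      then show "simple_root i \<in> range rvec"
        by blast
    qed
    have "rvec x + rvec y = rvec (\<lambda>i. x i + y i)" "a *\<^sub>R rvec x = rvec (\<lambda>i. a * x i)" "(0 :: complex^'a) = rvec (\<lambda>_. 0)"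
      for x y :: "'a \<Rightarrow> real" and a
      by (simp_all add: vec_eq_iff scaleR_conv_of_real[where 'a = complex])
    then show "subspace (range (rvec :: _ \<Rightarrow> complex^'a))"
      unfolding subspace_def by (auto simp del: rvec_nth)
  qed
  with assms that show thesis
    by blast
qed

subsection \<open>The kernel of an affine form\<close>

locale affine_cartan = cartan A d for A :: "int^'n^'n" and d +
  assumes affine: "affine_type A d"
begin

definition real_pairing :: "'n \<Rightarrow> ('n \<Rightarrow> real) \<Rightarrow> real" where
  "real_pairing i x = (\<Sum>j\<in>UNIV. of_int (A $ i $ j) * x j)"

definition quadratic :: "('n \<Rightarrow> real) \<Rightarrow> real" where
  "quadratic x = (\<Sum>i\<in>UNIV. \<Sum>j\<in>UNIV. d i * of_int (A $ i $ j) * (x i * x j))"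

lemma pairing_rvec: "pairing i (rvec x) = of_real (real_pairing i x)"
  by (simp add: pairing_def real_pairing_def)

lemma B_rvec: "B (rvec x) (rvec x) = of_real (quadratic x)"
  by (simp add: K_def quadratic_def mult_ac)

lemma quadratic_eq: "quadratic x = (\<Sum>i\<in>UNIV. d i * x i * real_pairing i x)"
  by (simp add: quadratic_def real_pairing_def sum_distrib_left mult_ac)

lemma quadratic_nonneg: "quadratic x \<ge> 0"
proof -
  have "rvec x \<in> span (range simple_root)"
    by (rule rvec_in_span) auto
  then have "0 \<le> Re (B (rvec x) (rvec x))"
    using affine by (simp add: affine_type_def pos_semidef_on_def)
  then show ?thesis
    by (simp add: B_rvec)
qed

text \<open>With coordinate \<open>k\<close> zero, \<open>rvec x\<close> lies in the span of a
  proper subset of the simple roots, where the form is positive definite.\<close>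

lemma quadratic_definite:
  assumes "quadratic x = 0" "x k = 0"
  shows "x i = 0"
proof (rule ccontr)
  assume "x i \<noteq> 0"
  then have "rvec x \<noteq> 0"
    by (auto simp: vec_eq_iff)
  moreover have "rvec x \<in> span (simple_root ` (- {k}))"
    using assms(2) by (intro rvec_in_span) auto
  moreover have "pos_def_on A d (- {k})"
    using affine unfolding affine_type_def by (metis Compl_eq_Diff_UNIV DiffD2 UNIV_I insertI1 psubsetI subset_UNIV)
  ultimately have "Re (B (rvec x) (rvec x)) > 0"
    unfolding pos_def_on_def by blast
  with assms(1) show False
    by (simp add: B_rvec)
qed

text \<open>Cauchy--Schwarz for \<open>x\<close> and the simple root of index \<open>i\<close>,
  whose norm is \<open>2 * d i\<close>.\<close>

lemma real_pairing_bound: "d i * (real_pairing i x)\<^sup>2 \<le> 2 * quadratic x"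
proof -
  \<comment> \<open>This multiple of the simple root, subtracted from \<open>x\<close>, minimizes
    the form.\<close>
  define t where "t = real_pairing i x / 2"
  define y where "y = (\<lambda>j. x j - (if i = j then t else 0))"
  have y: "rvec y = rvec x - of_real t *s simple_root i"
    by (simp add: vec_eq_iff y_def)
  have "of_real (quadratic y) = B (rvec y) (rvec y)"
    by (simp add: B_rvec)
  also have "\<dots> = of_real (quadratic x - d i * (real_pairing i x)\<^sup>2 / 2)"
  proof -
    have "B (rvec x) (simple_root i) = of_real (d i * real_pairing i x)"
      by (subst B_commute) (simp add: pairing_rvec)
    then show ?thesis
      by (simp add: y pairing_rvec B_rvec t_def diag algebra_simps power2_eq_square)
  qed
  finally have "quadratic y = quadratic x - d i * (real_pairing i x)\<^sup>2 / 2"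
    using of_real_eq_iff by blast
  then show ?thesis
    using quadratic_nonneg[of y] by simp
qed

text \<open>An isotropic vector of a semidefinite form lies in its radical, by the preceding
  bound.\<close>

lemma quadratic_zero_iff: "quadratic x = 0 \<longleftrightarrow> (\<forall>i. real_pairing i x = 0)"
proof
  assume "quadratic x = 0"
  show "\<forall>i. real_pairing i x = 0"
  proof
    fix i
    have "d i * (real_pairing i x)\<^sup>2 \<le> 0"
      using real_pairing_bound[of i x] \<open>quadratic x = 0\<close> by simp
    then show "real_pairing i x = 0"
      using d_pos[of i] by (simp add: mult_le_0_iff)
  qed
qed (simp add: quadratic_eq)

text \<open>Perron--Frobenius: off-diagonal entries are nonpositive, so taking absolute values does not
  increase the form.\<close>
lemma quadratic_abs: "quadratic x = 0 \<Longrightarrow> quadratic (\<lambda>i. \<bar>x i\<bar>) = 0"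
proof -
  assume "quadratic x = 0"
  have "quadratic (\<lambda>i. \<bar>x i\<bar>) \<le> quadratic x"
    unfolding quadratic_def
  proof (intro sum_mono)
    fix i j
    show "d i * of_int (A $ i $ j) * (\<bar>x i\<bar> * \<bar>x j\<bar>) \<le> d i * of_int (A $ i $ j) * (x i * x j)"
    proof (cases "i = j")
      case False
      then have "d i * of_int (A $ i $ j) \<le> 0"
        using offdiag[of i j] d_pos[of i] by (simp add: mult_le_0_iff)
      then show ?thesis
        by (intro mult_left_mono_neg) (simp_all flip: abs_mult)
    qed simp
  qed
  with \<open>quadratic x = 0\<close> show ?thesis
    using quadratic_nonneg[of "\<lambda>i. \<bar>x i\<bar>"] by simp
qed

lemma null_vector: obtains x where "x \<noteq> (\<lambda>_. 0)" "quadratic x = 0"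
proof -
  obtain v where v: "v \<in> span (range simple_root)" "v \<noteq> 0" "\<not> Re (B v v) > 0"
    using affine unfolding affine_type_def pos_def_on_def by blast
  obtain x where x: "v = rvec x"
    using span_simple_root_real[OF v(1)] .
  have "quadratic x = 0"
    using v(3) quadratic_nonneg[of x] by (simp add: x B_rvec)
  moreover have "x \<noteq> (\<lambda>_. 0)"
    using v(2) by (auto simp: x vec_eq_iff)
  ultimately show thesis
    using that by blast
qed

text \<open>An isotropic real vector yields an integer one, \<open>z\<close>. Its absolute values
  are again isotropic by Perron--Frobenius, and division by the gcd makes them coprime.\<close>

lemma marks_exist:
  obtains m :: "'n \<Rightarrow> int" where "\<And>i. m i > 0" "Gcd (range m) = 1" "quadratic (\<lambda>i. of_int (m i)) = 0"
proof -
  obtain x where x: "x \<noteq> (\<lambda>_. 0)" "quadratic x = 0"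
    by (rule null_vector)
  have "(\<chi> i. x i) \<noteq> 0" "(\<Sum>j\<in>UNIV. of_int (A $ i $ j) * (\<chi> i. x i) $ j) = 0" for i
    using x quadratic_zero_iff[of x] by (auto simp: vec_eq_iff real_pairing_def)
  then obtain z where z: "z \<noteq> (\<lambda>_. 0)" "\<And>i. (\<Sum>j\<in>UNIV. A $ i $ j * z j) = 0"
    using integer_kernel_vector by blast
  have "real_pairing i (\<lambda>i. of_int (z i)) = of_int (\<Sum>j\<in>UNIV. A $ i $ j * z j)" for i
    by (simp add: real_pairing_def)
  then have qz: "quadratic (\<lambda>i. of_int (z i)) = 0"
    unfolding quadratic_zero_iff using z(2) by simp
  \<comment> \<open>A single zero coordinate would force all of \<open>z\<close> to vanish.\<close>
  have z_nz: "z i \<noteq> 0" for i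
    using quadratic_definite[OF qz, of i] z(1) by auto
  define g where "g = Gcd (range z)"
  define m where "m i = \<bar>z i\<bar> div g" for i
  have g: "g > 0"
  proof -
    have "g \<noteq> 0"
      unfolding g_def Gcd_0_iff using z_nz by blast
    moreover have "g \<ge> 0"
      by (simp add: g_def)
    ultimately show ?thesis
      by linarith
  qed
  have "g dvd \<bar>z i\<bar>" for i
    by (simp add: g_def)
  then have gm: "\<bar>z i\<bar> = g * m i" for i
    by (simp add: m_def)
  have "m i > 0" for i
  proof -
    have "0 < g * m i"
      unfolding gm[symmetric] using z_nz[of i] by simp
    then show ?thesis
      using g by (simp add: zero_less_mult_iff)
  qed
  moreover have "Gcd (range m) = 1"
  proof -
    have "g = Gcd (range (\<lambda>i. \<bar>z i\<bar>))"
      using Gcd_abs_eq[of "range z"] by (simp add: g_def image_image)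
    also have "range (\<lambda>i. \<bar>z i\<bar>) = (*) g ` range m"
      unfolding gm image_image ..
    also have "Gcd \<dots> = g * Gcd (range m)"
      using g by (simp add: Gcd_mult abs_mult)
    finally show ?thesis
      using g by simp
  qed
  moreover have "quadratic (\<lambda>i. of_int (m i)) = 0"
  proof -
    have "(\<lambda>i. \<bar>of_int (z i)\<bar>) = (\<lambda>i. of_int g * real_of_int (m i))"
      by (simp add: gm flip: of_int_abs of_int_mult)
    with quadratic_abs[OF qz] have "\<forall>i. real_pairing i (\<lambda>i. of_int g * real_of_int (m i)) = 0"
      unfolding quadratic_zero_iff by simp
    moreover have "real_pairing i (\<lambda>i. of_int g * real_of_int (m i)) = of_int g * real_pairing i (\<lambda>i. of_int (m i))" for i
      by (simp add: real_pairing_def sum_distrib_left mult_ac)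
    ultimately show ?thesis
      unfolding quadratic_zero_iff using g by simp
  qed
  ultimately show thesis
    using that by blast
qed

text \<open>\<open>A\<close> is real, so the real and imaginary parts of \<open>v\<close> are null
  vectors separately.\<close>

lemma form_kernel_eq_0:
  assumes "v \<in> form_kernel A d" "v $ k = 0"
  shows "v = 0"
proof -
  have "real_pairing i (\<lambda>i. Re (v $ i)) = Re (pairing i v)" "real_pairing i (\<lambda>i. Im (v $ i)) = Im (pairing i v)" for i
    by (simp_all add: real_pairing_def pairing_def)
  then have "quadratic (\<lambda>i. Re (v $ i)) = 0" "quadratic (\<lambda>i. Im (v $ i)) = 0"
    unfolding quadratic_zero_iff using assms(1) by (simp_all add: form_kernel_iff)
  from quadratic_definite[OF this(1), of k] quadratic_definite[OF this(2), of k] assms(2) show ?thesis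
    by (simp add: vec_eq_iff complex_eq_iff)
qed

lemma form_kernel_eq_span:
  assumes "v \<in> form_kernel A d" "v $ k \<noteq> 0"
  shows "form_kernel A d = vec.span {v}"
proof
  show "form_kernel A d \<subseteq> vec.span {v}"
  proof
    fix u assume u: "u \<in> form_kernel A d"
    have "u - (u $ k / v $ k) *s v = 0"
      using u assms by (intro form_kernel_eq_0[of _ k]) (auto simp: form_kernel_iff)
    then show "u \<in> vec.span {v}"
      by (auto simp: vec.span_singleton)
  qed
  show "vec.span {v} \<subseteq> form_kernel A d"
    using assms(1) by (auto simp: vec.span_singleton form_kernel_iff)
qed

lemma sum_of_int_simple_root: "(\<Sum>i\<in>UNIV. of_int (m i) *s simple_root i) = rvec (\<lambda>i. of_int (m i))"
  by (subst vec_expansion[of "rvec _"]) simp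

text \<open>Justifies the definite description in \<open>delta\<close>. Two candidates are
  proportional, and coprimality of both coefficient families makes the factor 1.\<close>

lemma delta_ex1:
  "\<exists>!v. form_kernel A d = vec.span {v} \<and>
     (\<exists>m :: 'n \<Rightarrow> int. (\<forall>i. m i > 0) \<and> Gcd (range m) = 1 \<and>
        v = (\<Sum>i\<in>UNIV. of_int (m i) *s simple_root i))"
proof (rule ex_ex1I)
  obtain m :: "'n \<Rightarrow> int" where m: "\<And>i. m i > 0" "Gcd (range m) = 1" "quadratic (\<lambda>i. of_int (m i)) = 0"
    using marks_exist by blast
  let ?v = "rvec (\<lambda>i. of_int (m i)) :: complex^'n"
  have "?v \<in> form_kernel A d"
    using m(3) unfolding quadratic_zero_iff by (simp add: form_kernel_iff pairing_rvec)
  moreover have "?v $ i \<noteq> 0" for i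
    using m(1)[of i] by simp
  ultimately have "form_kernel A d = vec.span {?v}"
    by (rule form_kernel_eq_span)
  with m show "\<exists>v. form_kernel A d = vec.span {v} \<and>
     (\<exists>m :: 'n \<Rightarrow> int. (\<forall>i. m i > 0) \<and> Gcd (range m) = 1 \<and>
        v = (\<Sum>i\<in>UNIV. of_int (m i) *s simple_root i))"
    by (intro exI[of _ ?v] conjI exI[of _ m]) (simp_all add: sum_of_int_simple_root)
next
  fix v w
  assume v: "form_kernel A d = vec.span {v} \<and>
     (\<exists>m :: 'n \<Rightarrow> int. (\<forall>i. m i > 0) \<and> Gcd (range m) = 1 \<and>
        v = (\<Sum>i\<in>UNIV. of_int (m i) *s simple_root i))"
    and w: "form_kernel A d = vec.span {w} \<and>
     (\<exists>m :: 'n \<Rightarrow> int. (\<forall>i. m i > 0) \<and> Gcd (range m) = 1 \<and>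
        w = (\<Sum>i\<in>UNIV. of_int (m i) *s simple_root i))"
  obtain m :: "'n \<Rightarrow> int" where m: "\<And>i. m i > 0" "Gcd (range m) = 1" "v = rvec (\<lambda>i. of_int (m i))"
    using v by (auto simp: sum_of_int_simple_root)
  obtain l :: "'n \<Rightarrow> int" where l: "\<And>i. l i > 0" "Gcd (range l) = 1" "w = rvec (\<lambda>i. of_int (l i))"
    using w by (auto simp: sum_of_int_simple_root)
  have "w \<in> vec.span {v}"
    using v w by (metis singletonI vec.span_base)
  then obtain r where r: "w = r *s v"
    by (auto simp: vec.span_singleton)
  have "m i * l j = l i * m j" for i j
  proof -
    have "complex_of_int (m i * l j) = of_int (l i * m j)"
      using r by (simp add: m(3) l(3) vec_eq_iff)
    then show ?thesis
      by (simp only: of_int_eq_iff)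
  qed
  \<comment> \<open>Take the gcd over \<open>i\<close> on both sides of
    \<open>m j * l i = l j * m i\<close>.\<close>
  have "m j = l j" for j
  proof -
    have "m j = m j * Gcd (range l)"
      using l(2) by simp
    also have "\<dots> = Gcd ((*) (m j) ` range l)"
      using m(1)[of j] l(2) by (simp add: Gcd_mult)
    also have "(*) (m j) ` range l = (*) (l j) ` range m"
      unfolding image_image using \<open>\<And>i j. m i * l j = l i * m j\<close>[of j] by simp
    also have "Gcd ((*) (l j) ` range m) = l j"
      using l(1)[of j] m(2) by (simp add: Gcd_mult)
    finally show ?thesis .
  qed
  then show "v = w"
    by (simp add: m(3) l(3))
qed

section \<open>The imaginary root that spans the kernel\<close>

definition \<delta> :: "complex^'n" where
  "\<delta> = delta A d"

lemma form_kernel_eq_span_delta: "form_kernel A d = vec.span {\<delta>}"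
  and delta_marks: "\<exists>m :: 'n \<Rightarrow> int. \<forall>i. m i > 0 \<and> \<delta> $ i = of_int (m i)"
proof -
  have *: "form_kernel A d = vec.span {\<delta>} \<and>
     (\<exists>m :: 'n \<Rightarrow> int. (\<forall>i. m i > 0) \<and> Gcd (range m) = 1 \<and>
        \<delta> = (\<Sum>i\<in>UNIV. of_int (m i) *s simple_root i))"
    unfolding \<delta>_def delta_def by (rule theI') (rule delta_ex1)
  then show "form_kernel A d = vec.span {\<delta>}"
    by (rule conjunct1)
  obtain m :: "'n \<Rightarrow> int" where m: "\<forall>i. m i > 0" "\<delta> = rvec (\<lambda>i. of_int (m i))"
    using * unfolding sum_of_int_simple_root by blast
  have "\<delta> $ i = of_int (m i)" for i
    by (subst m(2)) simp
  with m(1) show "\<exists>m :: 'n \<Rightarrow> int. \<forall>i. m i > 0 \<and> \<delta> $ i = of_int (m i)"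
    by blast
qed

lemma delta_nth_nonzero [simp]: "\<delta> $ i \<noteq> 0"
proof -
  obtain m :: "'n \<Rightarrow> int" where m: "m i > 0" "\<delta> $ i = of_int (m i)"
    using delta_marks by blast
  from m(1) show ?thesis
    unfolding m(2) by simp
qed

lemma delta_nonzero [simp]: "\<delta> \<noteq> 0"
proof
  assume "\<delta> = 0"
  then have "\<delta> $ undefined = 0"
    by (simp only: zero_index)
  then show False
    by (simp only: delta_nth_nonzero)
qed

lemma form_kernel_iff_delta: "v \<in> form_kernel A d \<longleftrightarrow> (\<exists>a. v = a *s \<delta>)"
  unfolding form_kernel_eq_span_delta by (auto simp: vec.span_singleton)

lemma delta_in_kernel [simp]: "\<delta> \<in> form_kernel A d"
  unfolding form_kernel_iff_delta by (metis vec.scale_one)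

lemma pairing_delta [simp]: "pairing i \<delta> = 0"
  using delta_in_kernel by (simp only: form_kernel_iff)

lemma B_delta_left [simp]: "B \<delta> v = 0"
  using delta_in_kernel by (simp add: form_kernel_def)

lemma B_delta_right [simp]: "B v \<delta> = 0"
  by (subst B_commute) simp

lemma refl_product_delta [simp]: "refl_product A d is \<delta> = \<delta>"
  by (rule refl_product_form_kernel) simp

end

section \<open>Displacement of a vector by a product of reflections\<close>

context cartan
begin

definition part :: "'n list \<Rightarrow> complex^'n \<Rightarrow> complex^'n" where
  "part is v = (\<Sum>j\<in>set is. v $ j *s simple_root j)"

text \<open>The value of \<open>pairing i y\<close> at which \<open>s i\<close> adds exactly
  \<open>v $ i *s simple_root i\<close>, once the letters to its right have added their part of
  \<open>v\<close>. Indices outside the word get the default 0.\<close>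

primrec target :: "'n list \<Rightarrow> complex^'n \<Rightarrow> 'n \<Rightarrow> complex" where
  "target [] v i = 0"
| "target (j # is) v i = (if i = j then - (v $ i) - pairing i (part is v) else target is v i)"

lemma part_Cons: "i \<notin> set is \<Longrightarrow> part (i # is) v = v $ i *s simple_root i + part is v"
  by (simp add: part_def)

lemma part_UNIV: "set is = UNIV \<Longrightarrow> part is v = v"
  unfolding part_def by (simp flip: vec_expansion)

lemma target_add: "target is (u + v) i = target is u i + target is v i"
  and target_scale: "target is (a *s v) i = a * target is v i"
  by (induction "is") (auto simp: part_def algebra_simps sum.distrib sum_distrib_left)

text \<open>After the tail has added \<open>part is v\<close>, the pairing with \<open>j\<close> is
  \<open>- (v $ j)\<close>, so \<open>s j\<close> adds the missing term.\<close>

lemma refl_product_displacement: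
  assumes "distinct is" "\<And>i. i \<in> set is \<Longrightarrow> pairing i y = target is v i"
  shows "refl_product A d is y = y + part is v"
  using assms
proof (induction "is")
  case (Cons j "is")
  have "pairing i y = target is v i" if "i \<in> set is" for i
    using Cons.prems(1) Cons.prems(2)[of i] that by auto
  then have "refl_product A d is y = y + part is v"
    using Cons by simp
  then show ?case
    using Cons.prems(1) Cons.prems(2)[of j] by (simp add: s_eq part_Cons algebra_simps)
qed (simp add: part_def)

text \<open>Up to sign, the sum on the left is the Euler form, whose symmetrization is the form.\<close>
lemma target_diagonal:
  "distinct is \<Longrightarrow>
    2 * (\<Sum>i\<in>set is. of_real (d i) * v $ i * target is v i) = - B (part is v) (part is v)"
proof (induction "is")
  case (Cons j "is")
  have "(\<Sum>i\<in>set is. of_real (d i) * v $ i * target (j # is) v i)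
      = (\<Sum>i\<in>set is. of_real (d i) * v $ i * target is v i)"
    using Cons.prems by (intro sum.cong) auto
  moreover have "B (part is v) (simple_root j) = of_real (d j) * pairing j (part is v)"
    by (subst B_commute) simp
  ultimately show ?case
    using Cons by (simp add: part_Cons diag algebra_simps)
qed (simp add: part_def)

end

subsection \<open>Coxeter elements\<close>

locale affine_coxeter = affine_cartan A d for A :: "int^'n^'n" and d +
  fixes aff :: 'n and js :: "'n list"
  assumes distinct: "distinct js" and UNIV: "set js = UNIV"
begin

definition c :: "complex^'n \<Rightarrow> complex^'n" where
  "c = refl_product A d js"

lemma linear_c: "Vector_Spaces.linear (*s) (*s) c"
  unfolding c_def by (rule linear_refl_product)

lemma c_add [simp]: "c (u + v) = c u + c v"
  and c_diff [simp]: "c (u - v) = c u - c v"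
  and c_scale [simp]: "c (a *s v) = a *s c v"
  and c_zero [simp]: "c 0 = 0"
  using linear_c by (simp_all add: vec.linear_add vec.linear_diff vec.linear_scale vec.linear_0)

lemma c_delta [simp]: "c \<delta> = \<delta>"
  by (simp add: c_def)

lemma B_c [simp]: "B (c u) (c v) = B u v"
  by (simp add: c_def B_refl_product)

lemma c_fixed_iff: "c v = v \<longleftrightarrow> (\<exists>a. v = a *s \<delta>)"
proof
  assume "c v = v"
  then have "v \<in> form_kernel A d"
    unfolding c_def form_kernel_iff using refl_product_fixed[OF distinct] UNIV by auto
  then show "\<exists>a. v = a *s \<delta>"
    by (simp only: form_kernel_iff_delta)
qed auto

text \<open>The obstruction to solving \<open>c y - y = v\<close>: with \<open>pairing i y\<close>
  in place of \<open>target js v i\<close> the sum is \<open>B \<delta> y\<close>, which is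
  0.\<close>

definition euler :: "complex^'n \<Rightarrow> complex" where
  "euler v = (\<Sum>i\<in>UNIV. of_real (d i) * \<delta> $ i * target js v i)"

lemma euler_add: "euler (u + v) = euler u + euler v"
  and euler_scale: "euler (a *s v) = a * euler v"
  by (simp_all add: euler_def target_add target_scale algebra_simps sum.distrib sum_distrib_left)

lemma euler_delta: "euler \<delta> = 0"
  using target_diagonal[OF distinct, of \<delta>] by (simp add: euler_def UNIV part_UNIV)

text \<open>The left sides of \<open>pairing i y = target js v i\<close> satisfy a linear relation
  with weights \<open>d i * \<delta> $ i\<close>, and \<open>euler v = 0\<close> says that the right
  sides do too. So the equation at \<open>aff\<close> can be traded for the normalization
  \<open>y $ aff = 0\<close>.\<close>

lemma displacement_solvable:
  assumes "euler v = 0"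
  obtains y where "y $ aff = 0" "c y - y = v"
proof -
  define T :: "complex^'n \<Rightarrow> complex^'n" where "T y = (\<chi> i. if i = aff then y $ i else pairing i y)" for y
  have B_delta_pairing: "(\<Sum>i\<in>UNIV. of_real (d i) * \<delta> $ i * pairing i y) = 0" for y
    using B_delta_left[of y] by (simp only: B_eq)
  \<comment> \<open>The weight at \<open>aff\<close> is nonzero, so the relation recovers the
    equation given up there.\<close>
  have aff_determined: "g aff = 0"
    if "(\<Sum>i\<in>UNIV. of_real (d i) * \<delta> $ i * g i) = 0" "\<And>i. i \<noteq> aff \<Longrightarrow> g i = 0" for g
  proof -
    have "(\<Sum>i\<in>UNIV. of_real (d i) * \<delta> $ i * g i) = (\<Sum>i\<in>{aff}. of_real (d i) * \<delta> $ i * g i)"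
      using that(2) by (intro sum.mono_neutral_right) auto
    with that(1) d_pos[of aff] show ?thesis
      by simp
  qed
  have T: "Vector_Spaces.linear (*s) (*s) T"
    by (intro Vector_Spaces.linear_iff[THEN iffD2])
       (auto simp: vec.vector_space_axioms T_def vec_eq_iff)
  have "y = 0" if Ty: "T y = 0" for y
  proof -
    have Ty_nth: "T y $ i = 0" for i
      unfolding Ty by simp
    have pairing: "pairing i y = 0" if "i \<noteq> aff" for i
      using Ty_nth[of i] that by (simp add: T_def)
    have "pairing aff y = 0"
      using B_delta_pairing pairing by (rule aff_determined[of "\<lambda>i. pairing i y"])
    with pairing have "pairing i y = 0" for i
      by (cases "i = aff") auto
    then have "y \<in> form_kernel A d"
      by (simp add: form_kernel_iff)
    moreover have "y $ aff = 0"
      using Ty_nth[of aff] by (simp add: T_def)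
    ultimately show ?thesis
      by (rule form_kernel_eq_0)
  qed
  then have "inj T"
    using T by (simp add: vec.linear_inj_iff_eq_0)
  then have "surj T"
    using T by (intro vec.linear_inj_imp_surj)
  then obtain y where y: "T y = (\<chi> i. if i = aff then 0 else target js v i)"
    by (metis surjD)
  have Ty_nth: "T y $ i = (if i = aff then 0 else target js v i)" for i
    unfolding y by simp
  have pairing: "pairing i y - target js v i = 0" if "i \<noteq> aff" for i
    using Ty_nth[of i] that by (simp add: T_def)
  have "pairing aff y - target js v aff = 0"
    using assms B_delta_pairing[of y] pairing
    by (intro aff_determined[of "\<lambda>i. pairing i y - target js v i"])
       (simp_all add: euler_def right_diff_distrib sum_subtractf)
  with pairing have "pairing i y = target js v i" for i
    by (cases "i = aff") auto
  then have "c y = y + v"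
    unfolding c_def using refl_product_displacement[OF distinct] by (simp add: part_UNIV UNIV)
  moreover have "y $ aff = 0"
    using Ty_nth[of aff] by (simp add: T_def)
  ultimately show thesis
    by (intro that) auto
qed

text \<open>Two solutions differ by a fixed vector of \<open>c\<close>, which is a multiple of
  \<open>\<delta>\<close>, and \<open>\<delta> $ aff\<close> is nonzero.\<close>

lemma generalized_eigenvector_ex1: "\<exists>!v. gen_eigenvector_fin A d aff c v"
proof (rule ex_ex1I)
  show "\<exists>v. gen_eigenvector_fin A d aff c v"
    using displacement_solvable[OF euler_delta]
    unfolding gen_eigenvector_fin_def V_fin_iff \<delta>_def[symmetric] by blast
next
  fix u v
  assume uv: "gen_eigenvector_fin A d aff c u" "gen_eigenvector_fin A d aff c v"
  then have "c (u - v) = u - v"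
    unfolding gen_eigenvector_fin_def by (simp add: algebra_simps)
  then obtain a where a: "u - v = a *s \<delta>"
    unfolding c_fixed_iff by blast
  moreover have "(u - v) $ aff = 0"
    using uv by (simp add: gen_eigenvector_fin_def V_fin_iff)
  ultimately have "a = 0"
    by simp
  with a show "u = v"
    by simp
qed

definition \<gamma> :: "complex^'n" where
  "\<gamma> = gamma A d aff c"

lemma gamma: "gen_eigenvector_fin A d aff c \<gamma>"
  unfolding \<gamma>_def gamma_def by (rule theI') (rule generalized_eigenvector_ex1)

lemma gamma_unique: "gen_eigenvector_fin A d aff c v \<longleftrightarrow> v = \<gamma>"
  using gamma generalized_eigenvector_ex1 by blast

lemma c_gamma [simp]: "c \<gamma> = \<gamma> + \<delta>"
  using gamma by (simp add: gen_eigenvector_fin_def \<delta>_def diff_eq_eq add.commute)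

lemma c_power_delta [simp]: "(c ^^ k) \<delta> = \<delta>"
  by (induction k) auto

text \<open>A Jordan block at eigenvalue 1: no positive power of \<open>c\<close> fixes
  \<open>\<gamma>\<close>.\<close>

lemma c_power_gamma: "(c ^^ k) \<gamma> = \<gamma> + of_nat k *s \<delta>"
  by (induction k) (auto simp: algebra_simps)

section \<open>Powers of the Coxeter element modulo \<open>\<delta>\<close>\<close>

lemma linear_c_power: "Vector_Spaces.linear (*s) (*s) (c ^^ k)"
proof (induction k)
  case 0
  then show ?case
    unfolding funpow.simps by (rule vec.linear_id)
next
  case (Suc k)
  then show ?case
    unfolding funpow.simps by (rule Vector_Spaces.linear_compose[OF _ linear_c])
qed

lemma inj_c: "inj c"
proof (rule injI)
  fix u v assume "c u = c v"
  moreover have "refl_product A d (rev js) (c w) = w" for w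
    unfolding c_def using refl_product_rev[of "rev js"] by simp
  ultimately show "u = v"
    by metis
qed

lemma B_c_power: "B ((c ^^ k) u) ((c ^^ k) v) = B u v"
  by (induction k) auto

lemma c_power_simple_root_Ints: "(c ^^ k) (simple_root i) $ j \<in> \<int>"
  by (induction k arbitrary: j) (auto simp: c_def intro: refl_product_Ints)

text \<open>The lattice vectors \<open>c\<^sup>k \<alpha>\<^sub>i\<close> have constant norm, so by the Cauchy--Schwarz inequality there are
  only finitely many of them modulo \<open>\<delta>\<close>.\<close>
lemma c_power_simple_root_bound:
  "\<exists>M :: int. \<forall>k i j. \<exists>n \<in> {- M..M}. pairing j ((c ^^ k) (simple_root i)) = of_int n"
proof -
  \<comment> \<open>The sum over all pairs dominates every \<open>4 * d i / d j\<close>, so one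
    \<open>M\<close> serves all indices and powers.\<close>
  define M :: int where "M = \<lceil>\<Sum>i\<in>UNIV. \<Sum>j\<in>UNIV. 4 * d i / d j\<rceil>"
  have "\<exists>n \<in> {- M..M}. pairing j ((c ^^ k) (simple_root i)) = of_int n" for k i j
  proof -
    have "\<exists>z. \<forall>l. (c ^^ k) (simple_root i) $ l = of_int (z l)"
      using c_power_simple_root_Ints[of k i] by (intro choice) (auto elim: Ints_cases)
    then obtain z where z: "\<And>l. (c ^^ k) (simple_root i) $ l = of_int (z l)"
      by blast
    then have v: "(c ^^ k) (simple_root i) = rvec (\<lambda>l. of_int (z l))"
      by (simp add: vec_eq_iff)
    define n where "n = (\<Sum>l\<in>UNIV. A $ j $ l * z l)"
    have n: "real_pairing j (\<lambda>l. of_int (z l)) = of_int n"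
      by (simp add: real_pairing_def n_def)
    have "complex_of_real (quadratic (\<lambda>l. of_int (z l))) = of_real (2 * d i)"
      using B_c_power[of k "simple_root i" "simple_root i"] unfolding v B_rvec by (simp add: diag)
    then have "quadratic (\<lambda>l. of_int (z l)) = 2 * d i"
      using of_real_eq_iff by blast
    then have "(of_int n)\<^sup>2 \<le> 4 * d i / d j"
      using real_pairing_bound[of j "\<lambda>l. of_int (z l)"] d_pos[of j] by (simp add: n field_simps)
    also have "\<dots> \<le> (\<Sum>j\<in>UNIV. 4 * d i / d j)"
      using d_pos by (intro member_le_sum) (auto simp: less_imp_le)
    also have "\<dots> \<le> (\<Sum>i\<in>UNIV. \<Sum>j\<in>UNIV. 4 * d i / d j)"
      using d_pos by (intro member_le_sum[of i UNIV "\<lambda>i. \<Sum>j\<in>UNIV. 4 * d i / d j"] sum_nonneg) (auto simp: less_imp_le)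
    finally have "real_of_int (n\<^sup>2) \<le> (\<Sum>i\<in>UNIV. \<Sum>j\<in>UNIV. 4 * d i / d j)"
      by simp
    then have "n\<^sup>2 \<le> M"
      unfolding M_def by linarith
    moreover have "\<bar>n\<bar> \<le> n\<^sup>2"
      using self_le_power[of "\<bar>n\<bar>" 2] by (cases "n = 0") auto
    ultimately show ?thesis
      using n by (intro bexI[of _ n]) (auto simp: v pairing_rvec)
  qed
  then show ?thesis
    by blast
qed

text \<open>Pigeonhole: the table of pairings \<open>h k\<close> takes finitely many values, so two
  powers share it. On simple roots they then differ by kernel vectors, and \<open>c ^^ k\<close>
  cancels because it is injective and fixes \<open>\<delta>\<close>.\<close>

lemma c_power_mod_delta:
  "\<exists>N>0. \<forall>v. \<exists>a. (c ^^ N) v = v + a *s \<delta>"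
proof -
  obtain M :: int where M: "\<And>k i j. \<exists>n \<in> {- M..M}. pairing j ((c ^^ k) (simple_root i)) = of_int n"
    using c_power_simple_root_bound by blast
  define h where "h k i j = \<lfloor>Re (pairing j ((c ^^ k) (simple_root i)))\<rfloor>" for k i j
  have h: "pairing j ((c ^^ k) (simple_root i)) = of_int (h k i j)" "h k i j \<in> {- M..M}" for k i j
    using M[of j k i] by (auto simp: h_def)
  have "range h \<subseteq> (UNIV \<rightarrow>\<^sub>E UNIV \<rightarrow>\<^sub>E {- M..M})"
    using h(2) by auto
  then have "finite (range h)"
    by (rule finite_subset) (intro finite_PiE, auto)
  then have "\<not> inj h"
    using finite_imageD infinite_UNIV_nat by blast
  then obtain k l where kl: "k < l" "h k = h l"
    by (metis injI linorder_neqE_nat)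
  define N where "N = l - k"
  have "\<exists>a. (c ^^ N) (simple_root i) - simple_root i = a *s \<delta>" for i
  proof -
    have "(c ^^ l) (simple_root i) - (c ^^ k) (simple_root i) \<in> form_kernel A d"
      unfolding form_kernel_iff by (simp add: h(1) kl(2))
    then obtain a where a: "(c ^^ l) (simple_root i) - (c ^^ k) (simple_root i) = a *s \<delta>"
      unfolding form_kernel_iff_delta by blast
    have "(c ^^ l) (simple_root i) = (c ^^ k) ((c ^^ N) (simple_root i))"
      using kl(1) funpow_add[of k N c] by (simp add: N_def)
    moreover have "(c ^^ k) (a *s \<delta>) = a *s \<delta>"
      using vec.linear_scale[OF linear_c_power] by simp
    ultimately have "(c ^^ k) ((c ^^ N) (simple_root i) - simple_root i) = (c ^^ k) (a *s \<delta>)"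
      using a vec.linear_diff[OF linear_c_power] by simp
    moreover have "inj (c ^^ k)"
      using inj_c by (rule inj_fn)
    ultimately show ?thesis
      by (metis injD)
  qed
  then obtain a where a: "\<And>i. (c ^^ N) (simple_root i) = simple_root i + a i *s \<delta>"
    by (metis add.commute diff_add_cancel)
  have "(c ^^ N) v = v + (\<Sum>i\<in>UNIV. v $ i * a i) *s \<delta>" for v
  proof -
    have "(c ^^ N) v = (\<Sum>i\<in>UNIV. v $ i *s (simple_root i + a i *s \<delta>))"
      by (subst vec_expansion[of v])
         (simp add: vec.linear_sum[OF linear_c_power] vec.linear_scale[OF linear_c_power] a)
    also have "\<dots> = (\<Sum>i\<in>UNIV. v $ i *s simple_root i) + (\<Sum>i\<in>UNIV. v $ i * a i) *s \<delta>"
      by (simp add: vec.scale_right_distrib sum.distrib vec.scale_sum_left)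
    finally show ?thesis
      by (simp flip: vec_expansion)
  qed
  moreover have "N > 0"
    using kl(1) by (simp add: N_def)
  ultimately show ?thesis
    by (intro exI[of _ N] conjI allI exI)
qed

end

section \<open>The hyperplane orthogonal to \<open>\<gamma>\<close> and the eigenvectors of
  \<open>c\<close>\<close>

context affine_coxeter
begin

lemma gamma_not_in_kernel: "\<gamma> \<notin> form_kernel A d"
proof
  assume "\<gamma> \<in> form_kernel A d"
  then have "c \<gamma> = \<gamma>"
    unfolding c_def by (rule refl_product_form_kernel)
  then show False
    by simp
qed

text \<open>\<open>c\<close> preserves \<open>B\<close> and moves \<open>\<gamma>\<close> by
  \<open>\<delta>\<close>, which lies in the kernel.\<close>

lemma B_gamma_c [simp]: "B \<gamma> (c v) = B \<gamma> v"
  using B_c[of \<gamma> v] by simp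

text \<open>The functionals \<open>euler\<close> and \<open>B \<gamma>\<close> have the same kernel, namely the image of \<open>c - 1\<close>.\<close>
lemma displacement_image:
  assumes "B \<gamma> v = 0"
  obtains y where "c y - y = v"
proof -
  have euler_imp: "B \<gamma> w = 0" if w: "euler w = 0" for w
  proof -
    obtain y where "c y - y = w"
      using displacement_solvable[OF w] by blast
    then show ?thesis
      by (metis B_diff_right B_gamma_c diff_self)
  qed
  obtain a where a: "B \<gamma> a \<noteq> 0"
    using gamma_not_in_kernel by (auto simp: form_kernel_def)
  then have "euler a \<noteq> 0"
    using euler_imp by blast
  \<comment> \<open>Correct \<open>v\<close> by a multiple of \<open>a\<close> so that
    \<open>euler\<close> vanishes. Then \<open>B \<gamma>\<close> kills both the corrected vector
    and \<open>v\<close>, so the multiple is zero.\<close>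
  then have "euler (v + (- euler v / euler a) *s a) = 0"
    unfolding euler_add euler_scale by simp
  then have "B \<gamma> (v + (- euler v / euler a) *s a) = 0"
    by (rule euler_imp)
  with assms a \<open>euler a \<noteq> 0\<close> have "euler v = 0"
    by simp
  then show thesis
    using displacement_solvable that by blast
qed

text \<open>Write \<open>v\<close> as \<open>c y - y\<close>. The power \<open>c ^^ N\<close> moves
  \<open>y\<close> by a multiple of \<open>\<delta>\<close>, and \<open>c - 1\<close> annihilates
  this error.\<close>

lemma c_finite_order:
  "\<exists>N>0. (\<forall>v. B \<gamma> v = 0 \<longrightarrow> (c ^^ N) v = v)"
proof -
  obtain N where N: "N > 0" "\<And>v. \<exists>a. (c ^^ N) v = v + a *s \<delta>"
    using c_power_mod_delta by blast
  have "(c ^^ N) v = v" if v: "B \<gamma> v = 0" for v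
  proof -
    obtain y where y: "c y - y = v"
      using displacement_image[OF v] .
    obtain a where a: "(c ^^ N) y = y + a *s \<delta>"
      using N(2) by blast
    have "(c ^^ N) v = (c ^^ N) (c y) - (c ^^ N) y"
      unfolding y[symmetric] by (rule vec.linear_diff[OF linear_c_power])
    also have "(c ^^ N) (c y) = c ((c ^^ N) y)"
      by (simp add: funpow_swap1)
    also have "c ((c ^^ N) y) - (c ^^ N) y = v"
      unfolding a using y by simp
    finally show ?thesis .
  qed
  with N(1) show ?thesis
    by blast
qed

text \<open>Otherwise a positive power of \<open>c\<close> would fix \<open>\<gamma>\<close>,
  against \<open>c_power_gamma\<close>.\<close>

lemma B_gamma_gamma: "B \<gamma> \<gamma> \<noteq> 0"
proof
  assume "B \<gamma> \<gamma> = 0"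
  then obtain N where "N > 0" "(c ^^ N) \<gamma> = \<gamma>"
    using c_finite_order by blast
  then show False
    by (simp add: c_power_gamma)
qed

text \<open>For \<open>lam \<noteq> 1\<close> invariance gives
  \<open>B \<gamma> v = lam * B \<gamma> v\<close>; for \<open>lam = 1\<close> the vector is a
  multiple of \<open>\<delta>\<close>.\<close>

lemma eigenvector_B_gamma:
  assumes "c v = lam *s v"
  shows "B \<gamma> v = 0"
proof (cases "lam = 1")
  case True
  with assms obtain a where "v = a *s \<delta>"
    using c_fixed_iff by auto
  then show ?thesis
    by simp
next
  case False
  have "B \<gamma> v = lam * B \<gamma> v"
    using B_gamma_c[of v] by (simp add: assms)
  with False show ?thesis
    by simp
qed

definition unity_eigenvectors :: "(complex^'n) set" where
  "unity_eigenvectors = {v. \<exists>lam. eigenvector c lam v \<and> lam \<noteq> 1 \<and> (\<exists>k::nat. k > 0 \<and> lam ^ k = 1)}"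

text \<open>\<open>v\<close> is periodic under \<open>c\<close>, so it splits into components that
  \<open>c\<close> scales by roots of unity; those with factor 1 are multiples of
  \<open>\<delta>\<close>.\<close>

lemma gamma_perp_decomposition:
  assumes "B \<gamma> v = 0"
  shows "v \<in> vec.span (insert \<delta> unity_eigenvectors)" "v \<in> eigenspace_sum c"
proof -
  obtain N where N: "N > 0" "(c ^^ N) v = v"
    using c_finite_order assms by blast
  obtain w \<zeta> where w: "v = (\<Sum>j<N. w j)" "\<And>j. c (w j) = \<zeta> j *s w j" "\<And>j. \<zeta> j ^ N = 1"
    using root_of_unity_decomposition[OF linear_c N] by blast
  have "w j \<in> vec.span (insert \<delta> unity_eigenvectors)" for j
  proof (cases "\<zeta> j = 1 \<or> w j = 0")
    case True
    then have "c (w j) = w j"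
      using w(2)[of j] by auto
    then obtain a where "w j = a *s \<delta>"
      using c_fixed_iff by blast
    then show ?thesis
      by (simp add: vec.span_base vec.span_scale)
  next
    case False
    then have "w j \<in> unity_eigenvectors"
      using w(2,3) N(1) by (auto simp: unity_eigenvectors_def eigenvector_def)
    then show ?thesis
      by (simp add: vec.span_base)
  qed
  then show "v \<in> vec.span (insert \<delta> unity_eigenvectors)"
    unfolding w(1) by (rule vec.span_sum)
  have "w j \<in> vec.span (\<Union>lam. eigenspace c lam)" for j
    using w(2)[of j] by (intro vec.span_base) (auto simp: eigenspace_def)
  then show "v \<in> eigenspace_sum c"
    unfolding w(1) eigenspace_sum_def by (rule vec.span_sum)
qed

lemma eigenspace_sum_c: "eigenspace_sum c = {v. B \<gamma> v = 0}"
proof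
  show "eigenspace_sum c \<subseteq> {v. B \<gamma> v = 0}"
    unfolding eigenspace_sum_def
    by (rule vec.span_minimal)
       (auto simp: eigenspace_def vec.subspace_def intro: eigenvector_B_gamma)
  show "{v. B \<gamma> v = 0} \<subseteq> eigenspace_sum c"
    using gamma_perp_decomposition(2) by blast
qed

text \<open>A Jordan basis for \<open>c\<close>. For a maximal independent \<open>S\<close>, the set
  \<open>insert \<delta> S\<close> spans the hyperplane orthogonal to \<open>\<gamma>\<close>, and
  \<open>\<gamma>\<close> lies outside it.\<close>

lemma eigenbasis:
  obtains S where "S \<subseteq> unity_eigenvectors" "\<delta> \<notin> S" "\<gamma> \<notin> insert \<delta> S" "finite S" "CARD('n) = card S + 2"
    "\<not> vec.dependent (insert \<gamma> (insert \<delta> S))"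
proof -
  obtain S where S: "S \<subseteq> unity_eigenvectors" "\<not> vec.dependent S" "unity_eigenvectors \<subseteq> vec.span S"
    using vec.maximal_independent_subset[of unity_eigenvectors] by blast
  \<comment> \<open>The image of the hyperplane under \<open>c - 1\<close> separates
    \<open>\<delta>\<close> from the span of \<open>S\<close>. It contains \<open>S\<close>, but
    \<open>c y - y = \<delta>\<close> forces \<open>y\<close> to be \<open>\<gamma>\<close> plus a
    multiple of \<open>\<delta>\<close>, off the hyperplane.\<close>
  define X where "X = {v. \<exists>y. B \<gamma> y = 0 \<and> c y - y = v}"
  have "vec.subspace X"
  proof (rule vec.subspaceI)
    show "0 \<in> X"
      unfolding X_def by (intro CollectI exI[of _ 0]) simp
  next
    fix u v assume "u \<in> X" "v \<in> X"
    then obtain y z where "B \<gamma> y = 0" "c y - y = u" "B \<gamma> z = 0" "c z - z = v"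
      by (auto simp: X_def)
    then show "u + v \<in> X"
      unfolding X_def by (intro CollectI exI[of _ "y + z"]) auto
  next
    fix a v assume "v \<in> X"
    then obtain y where "B \<gamma> y = 0" "c y - y = v"
      by (auto simp: X_def)
    then show "a *s v \<in> X"
      unfolding X_def by (intro CollectI exI[of _ "a *s y"]) (auto simp: vec.scale_right_diff_distrib)
  qed
  moreover have "S \<subseteq> X"
  proof
    fix v assume "v \<in> S"
    then obtain lam where v: "c v = lam *s v" "lam \<noteq> 1"
      using S(1) by (auto simp: unity_eigenvectors_def eigenvector_def)
    define b where "b = 1 / (lam - 1)"
    have "c (b *s v) - b *s v = (b * lam - b) *s v"
      by (simp only: c_scale v(1) vec.scale_scale vec.scale_left_diff_distrib)
    also have "b * lam - b = b * (lam - 1)"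
      by (simp add: right_diff_distrib)
    also have "\<dots> = 1"
      using v(2) by (simp add: b_def)
    finally show "v \<in> X"
      unfolding X_def using eigenvector_B_gamma[OF v(1)]
      by (intro CollectI exI[of _ "b *s v"]) simp
  qed
  ultimately have "vec.span S \<subseteq> X"
    by (intro vec.span_minimal)
  moreover have "\<delta> \<notin> X"
  proof
    assume "\<delta> \<in> X"
    then obtain y where y: "B \<gamma> y = 0" "c y - y = \<delta>"
      by (auto simp: X_def)
    then have "c (y - \<gamma>) = y - \<gamma>"
      by (simp add: algebra_simps)
    then obtain a where "y - \<gamma> = a *s \<delta>"
      using c_fixed_iff by blast
    then have "B \<gamma> (y - \<gamma>) = 0"
      by simp
    with y(1) B_gamma_gamma show False
      by simp
  qed
  ultimately have \<delta>: "\<delta> \<notin> vec.span S"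
    by blast
  have perp: "vec.span (insert \<delta> S) = {v. B \<gamma> v = 0}"
  proof
    show "vec.span (insert \<delta> S) \<subseteq> {v. B \<gamma> v = 0}"
      using S(1) by (intro vec.span_minimal)
        (auto simp: vec.subspace_def unity_eigenvectors_def eigenvector_def intro: eigenvector_B_gamma)
    have "unity_eigenvectors \<subseteq> vec.span (insert \<delta> S)"
      using S(3) vec.span_mono[of S "insert \<delta> S"] by blast
    then have "vec.span (insert \<delta> unity_eigenvectors) \<subseteq> vec.span (insert \<delta> S)"
      by (intro vec.span_minimal) (auto intro: vec.span_base)
    then show "{v. B \<gamma> v = 0} \<subseteq> vec.span (insert \<delta> S)"
      using gamma_perp_decomposition(1) by blast
  qed
  then have \<gamma>: "\<gamma> \<notin> vec.span (insert \<delta> S)"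
    using B_gamma_gamma by simp
  have indep: "\<not> vec.dependent (insert \<gamma> (insert \<delta> S))"
    using S(2) \<delta> \<gamma> by (intro vec.independent_insertI)
  have "v \<in> vec.span (insert \<gamma> (insert \<delta> S))" for v
  proof -
    let ?a = "B \<gamma> v / B \<gamma> \<gamma>"
    have "v - ?a *s \<gamma> \<in> vec.span (insert \<delta> S)"
      unfolding perp using B_gamma_gamma by simp
    then show ?thesis
      using vec.in_span_insert[of "v - ?a *s \<gamma>"] vec.span_breakdown_eq[of v \<gamma>] by blast
  qed
  then have "card (insert \<gamma> (insert \<delta> S)) = vec.dim (UNIV :: (complex^'n) set)"
    using indep by (intro vec.basis_card_eq_dim) auto
  then have "card (insert \<gamma> (insert \<delta> S)) = CARD('n)"
    unfolding vec_dim_card .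
  moreover have "finite S" "\<delta> \<notin> S" "\<gamma> \<notin> insert \<delta> S"
    using S(2) \<delta> \<gamma> vec.finiteI_independent by (auto intro: vec.span_base)
  ultimately show thesis
    using that[of S] S(1) indep by simp
qed

lemma unity_eigenvectors_independent:
  "\<exists>S. finite S \<and> card S = CARD('n) - 2 \<and> \<not> vec.dependent S \<and>
     (\<forall>v\<in>S. \<exists>lam. eigenvector c lam v \<and> lam \<noteq> 1 \<and> (\<exists>k::nat. k > 0 \<and> lam ^ k = 1))"
proof -
  obtain S where "S \<subseteq> unity_eigenvectors" "finite S" "CARD('n) = card S + 2"
    "\<not> vec.dependent (insert \<gamma> (insert \<delta> S))"
    by (rule eigenbasis)
  moreover from this(4) have "\<not> vec.dependent S"
    by (rule contrapos_nn) (auto intro: vec.dependent_mono)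
  ultimately show ?thesis
    by (intro exI[of _ S]) (auto simp: unity_eigenvectors_def)
qed

lemma geometric_multiplicity_c: "geometric_multiplicity c 1 = 1"
proof -
  have "eigenspace c 1 = vec.span {\<delta>}"
    by (auto simp: eigenspace_def c_fixed_iff vec.span_singleton)
  then show ?thesis
    using vec.dim_eq_card_independent[of "{\<delta>}"] by (simp add: geometric_multiplicity_def)
qed

text \<open>In the basis from \<open>eigenbasis\<close> the only off-diagonal entry comes from
  \<open>c \<gamma> = \<gamma> + \<delta>\<close>. The diagonal is 1 at \<open>\<gamma>\<close> and
  \<open>\<delta>\<close> and differs from 1 elsewhere.\<close>

lemma algebraic_multiplicity_c: "algebraic_multiplicity c 1 = 2"
proof -
  obtain S where S: "S \<subseteq> unity_eigenvectors" "\<delta> \<notin> S" "\<gamma> \<notin> insert \<delta> S" "finite S"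
      "CARD('n) = card S + 2" "\<not> vec.dependent (insert \<gamma> (insert \<delta> S))"
    by (rule eigenbasis)
  have "card (insert \<gamma> (insert \<delta> S)) = CARD('n)"
    using S(2-5) by simp
  \<comment> \<open>Index the basis by the coordinate type, as
    \<open>charpoly_almost_diagonal\<close> expects.\<close>
  then obtain e where e: "bij_betw e (UNIV :: 'n set) (insert \<gamma> (insert \<delta> S))"
    using finite_same_card_bij[of "UNIV :: 'n set" "insert \<gamma> (insert \<delta> S)"] S(4) by auto
  then have inj: "inj e" and range: "range e = insert \<gamma> (insert \<delta> S)"
    by (auto simp: bij_betw_def)
  obtain p q where p: "e p = \<gamma>" and q: "e q = \<delta>"
    using range by (metis insertI1 insertI2 rangeE)
  have pq: "q \<noteq> p"
    using p q S(3) by auto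
  have "\<exists>lam. c (e i) = lam *s e i \<and> lam \<noteq> 1" if "i \<noteq> p" "i \<noteq> q" for i
  proof -
    have "e i \<in> S"
      using range that p q inj by (metis injD insertE rangeI)
    then show ?thesis
      using S(1) by (auto simp: unity_eigenvectors_def eigenvector_def)
  qed
  then obtain \<mu>0 where \<mu>0: "\<And>i. i \<noteq> p \<Longrightarrow> i \<noteq> q \<Longrightarrow> c (e i) = \<mu>0 i *s e i \<and> \<mu>0 i \<noteq> 1"
    by metis
  define \<mu> where "\<mu> i = (if i = p \<or> i = q then 1 else \<mu>0 i)" for i
  have "charpoly c = (\<Prod>i\<in>UNIV. [:- \<mu> i, 1:])"
  proof (rule charpoly_almost_diagonal[OF linear_c inj])
    show "\<not> vec.dependent (range e)"
      using S(6) by (simp add: range)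
    show "c (e i) = \<mu> i *s e i" if "i \<noteq> p" for i
      using that \<mu>0[of i] by (cases "i = q") (auto simp: \<mu>_def q)
    show "c (e p) = \<mu> p *s e p + e q"
      by (simp add: p q \<mu>_def)
    show "q \<noteq> p"
      by (rule pq)
  qed
  also have "\<dots> = [:- 1, 1:] ^ 2 * (\<Prod>i\<in>- {p, q}. [:- \<mu> i, 1:])"
  proof -
    have "(\<Prod>i\<in>UNIV. [:- \<mu> i, 1:]) = (\<Prod>i\<in>{p, q}. [:- \<mu> i, 1:]) * (\<Prod>i\<in>- {p, q}. [:- \<mu> i, 1:])"
      by (subst prod.union_disjoint[symmetric]) auto
    then show ?thesis
      using pq by (simp add: \<mu>_def power2_eq_square)
  qed
  finally have charpoly: "charpoly c = [:- 1, 1:] ^ 2 * (\<Prod>i\<in>- {p, q}. [:- \<mu> i, 1:])" .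
  have "poly (\<Prod>i\<in>- {p, q}. [:- \<mu> i, 1:]) 1 \<noteq> 0"
    using \<mu>0 by (auto simp: poly_prod \<mu>_def)
  then have "Polynomial.order 1 (\<Prod>i\<in>- {p, q}. [:- \<mu> i, 1:]) = 0"
    by (rule order_0I)
  moreover have "charpoly c \<noteq> 0"
    unfolding charpoly by auto
  ultimately show ?thesis
    unfolding algebraic_multiplicity_def charpoly
    using order_power_n_n[of 1 2] by (subst order_mult) simp_all
qed

subsection \<open>Reduction to the finite reflection group\<close>

definition \<theta> :: "complex^'n" where
  "\<theta> = theta A d aff"

lemma theta_aff: "\<theta> $ aff = 0"
  by (simp add: \<theta>_def theta_def \<delta>_def)

lemma pairing_theta: "pairing i \<theta> = - (\<delta> $ aff * of_int (A $ i $ aff))"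
  by (simp add: \<theta>_def theta_def flip: \<delta>_def)

lemma B_theta: "B \<theta> v = - (\<delta> $ aff * of_real (d aff) * pairing aff v)"
  by (simp add: \<theta>_def theta_def flip: \<delta>_def)

text \<open>Modulo the kernel, \<open>\<theta>\<close> is the simple root of \<open>aff\<close>
  times \<open>- (\<delta> $ aff)\<close>, so its coroot is the simple coroot divided by that
  factor.\<close>

lemma B_coroot_theta: "B (coroot A d \<theta>) v = - (pairing aff v / \<delta> $ aff)"
proof -
  have "B \<theta> \<theta> = 2 * (\<delta> $ aff)\<^sup>2 * of_real (d aff)"
    by (simp add: B_theta pairing_theta diag power2_eq_square)
  then show ?thesis
    using d_pos[of aff] by (simp add: coroot_def B_theta power2_eq_square)
qed

text \<open>The two displacements differ by a multiple of
  \<open>\<theta> + \<delta> $ aff *s simple_root aff\<close>, which is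
  \<open>\<delta>\<close>.\<close>

lemma s_aff_eq_reflection_theta: "s aff v = reflection A d \<theta> v + B (coroot A d \<theta>) v *s \<delta>"
proof -
  let ?x = "pairing aff v / \<delta> $ aff"
  have "?x *s \<delta> = ?x *s (\<theta> + \<delta> $ aff *s simple_root aff)"
    by (simp add: \<theta>_def theta_def flip: \<delta>_def)
  also have "\<dots> = ?x *s \<theta> + pairing aff v *s simple_root aff"
    by (simp add: vec.scale_right_distrib)
  finally show ?thesis
    by (simp add: s_eq reflection_def B_coroot_theta)
qed

end

section \<open>Comparison of \<open>c\<close> with \<open>c_fin\<close>\<close>

locale affine_coxeter_split = affine_coxeter A d aff "xs @ aff # ys"
  for A :: "int^'n^'n" and d aff xs ys
begin

definition c_fin :: "complex^'n \<Rightarrow> complex^'n" where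
  "c_fin = refl_product A d xs \<circ> reflection A d \<theta> \<circ> refl_product A d ys"

text \<open>The \<open>\<delta>\<close>-component of \<open>c v\<close> for \<open>v\<close> in
  \<open>V_fin aff\<close>.\<close>

definition \<kappa> :: "complex^'n \<Rightarrow> complex" where
  "\<kappa> v = B (coroot A d \<theta>) (refl_product A d ys v)"

lemma c_eq: "c v = c_fin v + \<kappa> v *s \<delta>"
  using linear_refl_product[of xs]
  by (simp add: c_def c_fin_def \<kappa>_def refl_product_append s_aff_eq_reflection_theta
      vec.linear_add vec.linear_scale)

text \<open>The index \<open>aff\<close> occurs in neither \<open>xs\<close> nor \<open>ys\<close>,
  and \<open>\<theta>\<close> has no \<open>aff\<close>-coordinate. Hence \<open>c_fin\<close>
  preserves \<open>V_fin aff\<close>.\<close>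

lemma c_fin_aff: "c_fin v $ aff = v $ aff"
  using distinct by (simp add: c_fin_def refl_product_nth reflection_def theta_aff)

text \<open>The sum of \<open>V_fin aff\<close> and the line through \<open>\<delta>\<close> is
  direct, as \<open>\<delta> $ aff\<close> is nonzero.\<close>

lemma V_fin_delta_cancel:
  assumes "u $ aff = 0" "v $ aff = 0"
  shows "u + a *s \<delta> = v + b *s \<delta> \<longleftrightarrow> u = v \<and> a = b"
proof
  assume eq: "u + a *s \<delta> = v + b *s \<delta>"
  then have "(u + a *s \<delta>) $ aff = (v + b *s \<delta>) $ aff"
    by simp
  then have "a = b"
    using assms by simp
  with eq show "u = v \<and> a = b"
    by simp
qed simp

text \<open>Compare the components of \<open>c v = v + \<delta>\<close> in that direct sum.\<close>

lemma gamma_characterization: "v $ aff = 0 \<and> c_fin v = v \<and> \<kappa> v = 1 \<longleftrightarrow> v = \<gamma>"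
proof -
  have "v = \<gamma> \<longleftrightarrow> v $ aff = 0 \<and> c v = v + 1 *s \<delta>"
    unfolding gamma_unique[symmetric] gen_eigenvector_fin_def V_fin_iff \<delta>_def[symmetric]
    by (auto simp: algebra_simps)
  then show ?thesis
    unfolding c_eq using V_fin_delta_cancel[of "c_fin v" v "\<kappa> v" 1] c_fin_aff[of v] by auto
qed

text \<open>The \<open>\<delta>\<close>-components of the eigenvalue equation match because
  \<open>a = \<kappa> v / (lam - 1)\<close> solves \<open>\<kappa> v + a = lam * a\<close>; what
  remains is the equation for \<open>c_fin\<close>.\<close>

lemma eigenvector_c_fin_iff:
  assumes "lam \<noteq> 1" "v $ aff = 0"
  shows "eigenvector c_fin lam v \<longleftrightarrow> eigenvector c lam (v + (\<kappa> v / (lam - 1)) *s \<delta>)"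
proof -
  let ?a = "\<kappa> v / (lam - 1)"
  have "c (v + ?a *s \<delta>) = c_fin v + (\<kappa> v + ?a) *s \<delta>"
    by (simp add: c_eq[of v] vec.scale_left_distrib)
  moreover have "lam *s (v + ?a *s \<delta>) = lam *s v + (lam * ?a) *s \<delta>"
    by (simp add: vec.scale_right_distrib)
  moreover have "\<kappa> v + ?a = lam * ?a"
    using assms(1) by (simp add: field_simps)
  ultimately have eig: "c (v + ?a *s \<delta>) = lam *s (v + ?a *s \<delta>) \<longleftrightarrow> c_fin v = lam *s v"
    using V_fin_delta_cancel[of "c_fin v" "lam *s v" "\<kappa> v + ?a" "lam * ?a"] assms(2) c_fin_aff[of v]
    by simp
  \<comment> \<open>The correction term vanishes with \<open>v\<close>, so the two nonzero
    conditions on eigenvectors agree.\<close>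
  have "\<kappa> 0 = 0"
    using linear_refl_product[of ys] by (simp add: \<kappa>_def vec.linear_0)
  then have "v + ?a *s \<delta> = 0 \<longleftrightarrow> v = 0"
    using V_fin_delta_cancel[of v 0 ?a 0] assms(2) by auto
  with eig show ?thesis
    by (simp add: eigenvector_def)
qed

end

theorem proposition3p1:
  fixes A :: "int^'n^'n" and d :: "'n \<Rightarrow> real" and aff :: 'n and xs ys :: "'n list"
    and c c_left c_right c_fin :: "complex^'n \<Rightarrow> complex^'n" and \<theta> \<delta> \<gamma> :: "complex^'n"
  assumes cartan: "symmetrizable_cartan A d"
    and affine: "affine_type A d"
    and aff: "affine_index A d aff"
    and order: "distinct (xs @ aff # ys)" "set (xs @ aff # ys) = UNIV"
    and c: "c = refl_product A d (xs @ aff # ys)"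
    and c_left: "c_left = refl_product A d xs"
    and c_right: "c_right = refl_product A d ys"
    and \<delta>: "\<delta> = delta A d"
    and \<theta>: "\<theta> = theta A d aff"
    and c_fin: "c_fin = c_left \<circ> reflection A d \<theta> \<circ> c_right"
    and \<gamma>: "\<gamma> = gamma A d aff c"
  shows
    "(algebraic_multiplicity c 1 = 2 \<and> geometric_multiplicity c 1 = 1 \<and> eigenvector c 1 \<delta>) \<and>
     ((\<exists>!v. gen_eigenvector_fin A d aff c v) \<and>
      (\<forall>v. (v \<in> V_fin aff \<and> c_fin v = v \<and> K A d (coroot A d \<theta>) (c_right v) = 1) \<longleftrightarrow> v = \<gamma>)) \<and>
     (\<exists>S. finite S \<and> card S = CARD('n) - 2 \<and> \<not> vec.dependent S \<and>
        (\<forall>v\<in>S. \<exists>lam. eigenvector c lam v \<and> lam \<noteq> 1 \<and> (\<exists>k::nat. k > 0 \<and> lam ^ k = 1))) \<and>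
     eigenspace_sum c = {v. K A d \<gamma> v = 0} \<and>
     (\<forall>lam v. lam \<noteq> 1 \<longrightarrow> v \<in> V_fin aff \<longrightarrow>
        (eigenvector c_fin lam v \<longleftrightarrow>
         eigenvector c lam (v + (K A d (coroot A d \<theta>) (c_right v) / (lam - 1)) *s \<delta>)))"
proof -
  interpret C: affine_coxeter_split A d aff xs ys
    by unfold_locales (fact cartan affine order)+
  have c_eq: "C.c = c" and \<delta>_eq: "C.\<delta> = \<delta>" and \<theta>_eq: "C.\<theta> = \<theta>"
    by (simp_all add: C.c_def c C.\<delta>_def \<delta> C.\<theta>_def \<theta>)
  then have \<gamma>_eq: "C.\<gamma> = \<gamma>" and c_fin_eq: "C.c_fin = c_fin"
    and \<kappa>_eq: "C.\<kappa> v = K A d (coroot A d \<theta>) (c_right v)" for v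
    by (simp_all add: C.\<gamma>_def \<gamma> C.c_fin_def c_fin c_left c_right C.\<kappa>_def)
  note eqs = c_eq \<delta>_eq \<gamma>_eq c_fin_eq \<kappa>_eq
  show ?thesis
  proof (intro conjI allI impI)
    show "eigenvector c 1 \<delta>"
      using C.c_delta C.delta_nonzero by (simp only: eigenvector_def eqs vec.scale_one) simp
    show "v \<in> V_fin aff \<and> c_fin v = v \<and> K A d (coroot A d \<theta>) (c_right v) = 1 \<longleftrightarrow> v = \<gamma>" for v
      using C.gamma_characterization[of v] by (simp only: eqs V_fin_iff)
    show "eigenvector c_fin lam v \<longleftrightarrow>
        eigenvector c lam (v + (K A d (coroot A d \<theta>) (c_right v) / (lam - 1)) *s \<delta>)"
      if "lam \<noteq> 1" "v \<in> V_fin aff" for lam v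
      using C.eigenvector_c_fin_iff[OF that[unfolded V_fin_iff]] unfolding eqs .
  qed (fact C.algebraic_multiplicity_c[unfolded eqs] C.geometric_multiplicity_c[unfolded eqs]
      C.generalized_eigenvector_ex1[unfolded eqs] C.unity_eigenvectors_independent[unfolded eqs]
      C.eigenspace_sum_c[unfolded eqs])+
qed

end
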